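(* Let $f:\mathbb{D}\to\mathbb{C}$ be a conformal (i.e. analytic and injective) mapping of the unit disk $\mathbb{D}=\{z\in\mathbb{C}:|z|<1\}$ with $f(1)=\infty$. Then $f\in Co$ (i.e. $\mathbb{C}\setminus f(\mathbb{D})$ is convex) if and only if $$|Sf(z)|\,(1-|z|^2)^2+2\leq 2|A_f(z)|^2\qquad\text{for all } z\in\mathbb{D}.$$
   Context: The condition $f(1)=\infty$ means $f(z)\to\infty$ as $z\to 1$, $z\in\mathbb{D}$. The class $Co$ (analytic concave mappings) consists of the univalent analytic functions $f:\mathbb{D}\to\mathbb{C}$ with $f(1)=\infty$ such that the complement $\mathbb{C}\setminus f(\mathbb{D})$ is convex. For a locally univalent function $f$, the Schwarzian derivative is $$Sf=\left(\frac{f''}{f'}\right)'-\frac12\left(\frac{f''}{f'}\right)^2,$$ and $$A_f(z)=\frac12\left((1-|z|^2)\frac{f''(z)}{f'(z)}-2\overline z\right).$$ *)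

theory Defs
  imports "HOL-Complex_Analysis.Complex_Analysis"
begin

abbreviation unit_disk :: "complex set"
  where "unit_disk \<equiv> ball 0 1"

text \<open>\<open>f(1) = \<infinity>\<close>: the limit is unrestricted within the disk, not merely radial or
  nontangential.\<close>

definition infinite_at_one :: "(complex \<Rightarrow> complex) \<Rightarrow> bool"
  where "infinite_at_one f \<longleftrightarrow> filterlim f at_infinity (at 1 within unit_disk)"

text \<open>Functions are total in HOL; only the values on the disk matter for membership.\<close>

definition Co :: "(complex \<Rightarrow> complex) set"
  where "Co = {f. f holomorphic_on unit_disk \<and> inj_on f unit_disk \<and> infinite_at_one f
                  \<and> convex (- (f ` unit_disk))}"

definition pre_schwarzian :: "(complex \<Rightarrow> complex) \<Rightarrow> complex \<Rightarrow> complex"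
  where "pre_schwarzian f z = deriv (deriv f) z / deriv f z"

definition schwarzian :: "(complex \<Rightarrow> complex) \<Rightarrow> complex \<Rightarrow> complex"
  where "schwarzian f z = deriv (pre_schwarzian f) z - 1/2 * (pre_schwarzian f z)\<^sup>2"

definition A_op :: "(complex \<Rightarrow> complex) \<Rightarrow> complex \<Rightarrow> complex"
  where "A_op f z =
    1/2 * (of_real (1 - (cmod z)\<^sup>2) * pre_schwarzian f z - 2 * cnj z)"

end

theory Submission
  imports Defs
begin

text \<open>Consider the Moebius transformation that agrees with \<open>f\<close> to second order at \<open>z\<close>. Its pole is
  \<open>\<psi>(z) = z + 2 f'(z) / f''(z)\<close>. In terms of \<open>\<psi>\<close> one has \<open>A\<^sub>f = (1 - cnj z \<psi>) / (\<psi> - z)\<close> and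
  \<open>Sf = - 2 \<psi>' / (\<psi> - z)\<^sup>2\<close>, and after multiplication by \<open>\<bar>\<psi> - z\<bar>\<^sup>2\<close> and simplification the inequality
  of the theorem becomes \<open>\<bar>\<psi>'\<bar> (1 - \<bar>z\<bar>\<^sup>2) \<le> 1 - \<bar>\<psi>\<bar>\<^sup>2\<close>. This is the Schwarz-Pick inequality. So the
  inequality holds on the disk if and only if \<open>\<psi>\<close> maps the disk into its closure, that is, if and only
  if \<open>\<bar>A\<^sub>f\<bar> \<ge> 1\<close> (\<open>schwarzian_bound_iff_A_op_ge_1\<close>). It remains to see that \<open>\<bar>A\<^sub>f\<bar> \<ge> 1\<close> characterizes
  convexity of the complement.

  Let \<open>\<bar>A\<^sub>f\<bar> \<ge> 1\<close>. Then \<open>\<psi>\<close> has no fixed point, so by Wolff's lemma (\<open>Wolff_boundary_point\<close>) there is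
  a boundary point \<open>\<zeta>\<close> all of whose horodisks \<open>\<psi>\<close> maps into their closures. If \<open>F\<close> is \<open>f\<close> transplanted
  to the right half plane with \<open>\<zeta>\<close> going to infinity, this says that \<open>Re (F'' / F') \<ge> 0\<close>. Hence \<open>\<bar>F'\<bar>\<close>
  increases along horizontal rays and \<open>F\<close> is bounded along the rays that end at a finite boundary
  point; since \<open>f(1) = \<infinity>\<close>, the point \<open>\<zeta>\<close> must be \<open>1\<close>. If now a segment between two omitted values met
  the image of \<open>F\<close>, then the real part of the inverse of \<open>F\<close> would have a positive maximum on it. At a
  critical point its second derivative along the segment is a positive multiple of \<open>Re (F'' / F')\<close>, so
  \<open>F'' / F'\<close> would be an imaginary constant, and \<open>F\<close> affine or exponential, which is excluded directly
  (\<open>convex_complement_half_plane_image\<close>).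

  Conversely, let the complement \<open>K\<close> of the image be convex. Consider first a compact convex \<open>K\<close> and a
  conformal map \<open>h\<close> of the disk onto its exterior in the sphere, with pole at \<open>0\<close>. The mean of
  \<open>h(e\<^sup>i\<^sup>\<alpha> z)\<close> and \<open>h(e\<^sup>-\<^sup>i\<^sup>\<alpha> z)\<close> approaches \<open>K\<close> when \<open>z\<close> approaches the circle, so by the maximum
  principle its preimage under \<open>h\<close> has modulus at least \<open>\<bar>z\<bar>\<close>. Expansion to second order in \<open>\<alpha>\<close> gives
  \<open>Re (1 + z h'' / h') \<le> 0\<close>, and this implies \<open>\<bar>A\<^sub>h\<bar> \<ge> 1\<close> (\<open>A_op_h_ge_1\<close>). The actual \<open>K\<close> is
  unbounded; it is exhausted by its intersections with large disks. By the theorems of Montel and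
  Hurwitz the conformal maps onto the exteriors have derivatives at the base point that come as close
  in modulus to that of \<open>f\<close> as desired (\<open>exhaustion_derivative_limit\<close>), and the bound for the second
  coefficient of a self-map of the disk transfers the estimate to \<open>f\<close>.\<close>

section \<open>The pre-Schwarzian derivative\<close>

lemma eventually_analytic_at:
  assumes "f analytic_on {z}"
  shows "eventually (\<lambda>w. f analytic_on {w}) (nhds z)"
proof -
  obtain S where "open S" "z \<in> S" "f holomorphic_on S"
    using assms analytic_at by blast
  then show ?thesis
    by (auto simp: eventually_nhds analytic_at intro!: exI[of _ S])
qed

lemma pre_schwarzian_cong_deriv:
  assumes "eventually (\<lambda>w. deriv f w = deriv g w) (nhds z)"
  shows "pre_schwarzian f z = pre_schwarzian g z"
proof -
  have "deriv f z = deriv g z"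
    by (rule eventually_nhds_x_imp_x[OF assms])
  moreover have "deriv (deriv f) z = deriv (deriv g) z"
    by (rule deriv_cong_ev[OF assms refl])
  ultimately show ?thesis
    by (simp add: pre_schwarzian_def)
qed

lemma pre_schwarzian_cong_ev:
  assumes "eventually (\<lambda>w. f w = g w) (nhds z)"
  shows "pre_schwarzian f z = pre_schwarzian g z"
proof (rule pre_schwarzian_cong_deriv)
  have "eventually (\<lambda>w. eventually (\<lambda>w. f w = g w) (nhds w)) (nhds z)"
    using assms by (simp only: eventually_eventually)
  then show "eventually (\<lambda>w. deriv f w = deriv g w) (nhds z)"
    by eventually_elim (rule deriv_cong_ev, auto)
qed

text \<open>The pre-Schwarzian is the logarithmic derivative of the first derivative, so the chain rule becomes
  additive.\<close>

lemma pre_schwarzian_compose: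
  assumes f: "f analytic_on {g z}" and g: "g analytic_on {z}"
    and nz: "deriv f (g z) \<noteq> 0" "deriv g z \<noteq> 0"
  shows "pre_schwarzian (\<lambda>z. f (g z)) z = pre_schwarzian f (g z) * deriv g z + pre_schwarzian g z"
proof -
  have g1: "(g has_field_derivative deriv g z) (at z)"
    by (simp add: analytic_derivI g)
  have "eventually (\<lambda>w. f analytic_on {w}) (nhds (g z))"
    by (rule eventually_analytic_at[OF f])
  moreover have "filterlim g (nhds (g z)) (nhds z)"
    using g1 DERIV_isCont isCont_def tendsto_at_iff_tendsto_nhds by blast
  ultimately have "eventually (\<lambda>w. f analytic_on {g w}) (nhds z)"
    by (rule eventually_compose_filterlim)
  moreover have "eventually (\<lambda>w. g analytic_on {w}) (nhds z)"
    by (rule eventually_analytic_at[OF g])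
  ultimately have ev: "eventually (\<lambda>w. deriv (\<lambda>z. f (g z)) w = deriv f (g w) * deriv g w) (nhds z)"
  proof eventually_elim
    case (elim w)
    show ?case
      by (rule DERIV_imp_deriv, rule DERIV_chain2[where g = g])
        (use elim in \<open>auto intro: analytic_derivI\<close>)
  qed
  have f2: "(deriv f has_field_derivative deriv (deriv f) (g z)) (at (g z))"
    using f by (simp add: analytic_derivI analytic_deriv)
  have g2: "(deriv g has_field_derivative deriv (deriv g) z) (at z)"
    using g by (simp add: analytic_derivI analytic_deriv)
  have "((\<lambda>w. deriv f (g w) * deriv g w) has_field_derivative
      deriv (deriv f) (g z) * deriv g z * deriv g z + deriv f (g z) * deriv (deriv g) z) (at z)"
    using f2 g1 g2 by (auto intro!: derivative_eq_intros DERIV_chain2[where g = g] simp: algebra_simps)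
  then have "deriv (deriv (\<lambda>z. f (g z))) z
      = deriv (deriv f) (g z) * deriv g z * deriv g z + deriv f (g z) * deriv (deriv g) z"
    by (simp add: DERIV_imp_deriv deriv_cong_ev[OF ev refl])
  with nz show ?thesis
    by (simp add: pre_schwarzian_def eventually_nhds_x_imp_x[OF ev] field_simps)
qed

lemma moebius_map_has_field_derivative:
  assumes "c * z + d \<noteq> 0"
  shows "((\<lambda>z. (a * z + b) / (c * z + d)) has_field_derivative (a * d - b * c) / (c * z + d)\<^sup>2) (at (z::complex))"
  using assms by (auto intro!: derivative_eq_intros simp: field_simps power2_eq_square)

lemma pre_schwarzian_moebius_map:
  assumes "c * z + d \<noteq> 0" "a * d - b * c \<noteq> 0"
  shows "pre_schwarzian (\<lambda>z. (a * z + b) / (c * z + d)) z = - 2 * c / (c * z + d)"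
proof -
  let ?S = "{z. c * z + d \<noteq> 0}"
  have "open ?S"
    by (intro open_Collect_neq continuous_intros)
  then have "eventually (\<lambda>z. z \<in> ?S) (nhds z)"
    using assms by (intro eventually_nhds_in_open) auto
  then have ev: "eventually (\<lambda>z. deriv (\<lambda>z. (a * z + b) / (c * z + d)) z = (a * d - b * c) / (c * z + d)\<^sup>2) (nhds z)"
    by eventually_elim (auto intro!: DERIV_imp_deriv moebius_map_has_field_derivative)
  have "((\<lambda>x. (a * d - b * c) / x\<^sup>2) has_field_derivative - 2 * (a * d - b * c) / x ^ 3) (at x)"
    if "x \<noteq> 0" for x
    using that by (auto intro!: derivative_eq_intros simp: power2_eq_square power3_eq_cube divide_simps)
  moreover have "((\<lambda>z. c * z + d) has_field_derivative c) (at z)"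
    by (auto intro!: derivative_eq_intros)
  ultimately have "((\<lambda>z. (a * d - b * c) / (c * z + d)\<^sup>2) has_field_derivative
      - 2 * (a * d - b * c) / (c * z + d) ^ 3 * c) (at z)"
    using assms(1) by (intro DERIV_chain2[where g = "\<lambda>z. c * z + d"])
  then have deriv2: "deriv (deriv (\<lambda>z. (a * z + b) / (c * z + d))) z = - 2 * (a * d - b * c) / (c * z + d) ^ 3 * c"
    by (simp add: DERIV_imp_deriv deriv_cong_ev[OF ev refl])
  have quotient: "(- 2 * k / x ^ 3 * c) / (k / x\<^sup>2) = - 2 * c / x" if "k \<noteq> 0" "x \<noteq> 0" for k x
    using that by (simp add: power2_eq_square power3_eq_cube)
  show ?thesis
    unfolding pre_schwarzian_def eventually_nhds_x_imp_x[OF ev] deriv2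
    by (rule quotient) (use assms in simp_all)
qed

lemma moebius_map_analytic:
  assumes "c * z + d \<noteq> 0"
  shows "(\<lambda>z. (a * z + b) / (c * z + d)) analytic_on {z}"
  using assms by (auto intro!: analytic_intros)

section \<open>The Schwarz-Pick inequality and subordination\<close>

lemma cmod_moebius_identity:
  "(cmod (1 - cnj z * s))\<^sup>2 - (cmod (s - z))\<^sup>2 = (1 - (cmod z)\<^sup>2) * (1 - (cmod s)\<^sup>2)"
  unfolding cmod_power2 by (simp add: algebra_simps power2_eq_square)

lemma one_minus_cmod_square_pos: "z \<in> unit_disk \<Longrightarrow> 0 < 1 - (cmod z)\<^sup>2"
  by (simp add: abs_square_less_1)

lemma one_minus_cmod_Moebius_function:
  assumes "cmod a < 1" "cmod z < 1"
  shows "1 - (cmod (Moebius_function 0 a z))\<^sup>2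
         = (1 - (cmod a)\<^sup>2) * (1 - (cmod z)\<^sup>2) / (cmod (1 - cnj a * z))\<^sup>2"
proof -
  have "cmod (cnj a * z) < 1"
    using norm_mult_less[of "cnj a" 1 z 1] assms by simp
  then have nz: "1 - cnj a * z \<noteq> 0"
    by auto
  have "(cmod (1 - cnj a * z))\<^sup>2 - (cmod (z - a))\<^sup>2 = (1 - (cmod a)\<^sup>2) * (1 - (cmod z)\<^sup>2)"
    by (rule cmod_moebius_identity)
  moreover have "(cmod (Moebius_function 0 a z))\<^sup>2 = (cmod (z - a))\<^sup>2 / (cmod (1 - cnj a * z))\<^sup>2"
    by (simp add: Moebius_function_simple norm_divide power_divide)
  moreover have "(cmod (1 - cnj a * z))\<^sup>2 \<noteq> 0"
    using nz by simp
  ultimately show ?thesis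
    by (metis diff_divide_distrib divide_self)
qed

lemma has_field_derivative_Moebius_function:
  assumes "1 - cnj a * z \<noteq> 0"
  shows "(Moebius_function 0 a has_field_derivative of_real (1 - (cmod a)\<^sup>2) / (1 - cnj a * z)\<^sup>2) (at z)"
proof -
  have eq: "of_real (1 - (cmod a)\<^sup>2) = 1 - cnj a * a"
    by (metis complex_norm_square mult.commute of_real_1 of_real_diff)
  have "((\<lambda>z. (z - a) / (1 - cnj a * z)) has_field_derivative (1 - cnj a * a) / (1 - cnj a * z)\<^sup>2) (at z)"
    using assms by (auto intro!: derivative_eq_intros simp: field_simps power2_eq_square)
  then show ?thesis
    unfolding eq by (simp add: Moebius_function_def)
qed

lemma bij_betw_Moebius_function:
  assumes "cmod b < 1"
  shows "bij_betw (Moebius_function 0 b) unit_disk unit_disk"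
  by (rule bij_betw_byWitness[where f' = "Moebius_function 0 (- b)"])
    (use assms Moebius_function_compose[of b "- b"] Moebius_function_compose[of "- b" b] Moebius_function_norm_lt_1 in auto)

lemma Schwarz_Pick:
  assumes u: "u holomorphic_on unit_disk" "u \<in> unit_disk \<rightarrow> unit_disk"
    and a: "a \<in> unit_disk" and z: "z \<in> unit_disk"
  shows "cmod (Moebius_function 0 (u a) (u z)) \<le> cmod (Moebius_function 0 a z)" (is ?pair)
    and "cmod (deriv u a) * (1 - (cmod a)\<^sup>2) \<le> 1 - (cmod (u a))\<^sup>2" (is ?deriv)
proof -
  let ?M = "Moebius_function 0"
  \<comment> \<open>Conjugating with disk automorphisms makes 0 a fixed point, so that the Schwarz lemma applies.\<close>
  define k where "k = ?M (u a) \<circ> (u \<circ> ?M (-a))"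
  have ua: "cmod (u a) < 1" "cmod a < 1" "cmod z < 1"
    using u(2) a z by (auto simp: Pi_iff)
  have M: "?M b holomorphic_on unit_disk" "?M b ` unit_disk \<subseteq> unit_disk" if "cmod b < 1" for b
    using that by (auto simp: Moebius_function_holomorphic Moebius_function_norm_lt_1)
  have hol: "k holomorphic_on unit_disk"
    unfolding k_def using u M[of "-a"] M[of "u a"] ua
    by (intro holomorphic_on_compose_gen[where t = unit_disk]) (auto simp: Pi_iff image_subset_iff)
  have k0: "k 0 = 0"
    by (simp add: k_def Moebius_function_of_zero Moebius_function_eq_zero)
  have kdisk: "cmod (k w) < 1" if "cmod w < 1" for w
    using that M[of "-a"] M[of "u a"] u(2) ua by (auto simp: k_def Pi_iff image_subset_iff)
  have "cmod (k (?M a z)) \<le> cmod (?M a z)"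
    by (rule Schwarz_Lemma(1)[OF hol k0 kdisk]) (use ua Moebius_function_norm_lt_1 in auto)
  moreover have "?M (-a) (?M a z) = z"
    using Moebius_function_compose[of "-a" a z] ua by simp
  ultimately show ?pair
    by (simp add: k_def)
  have du: "(u has_field_derivative deriv u a) (at a)"
    using u(1) a by (simp add: holomorphic_derivI)
  have dM0: "(?M (-a) has_field_derivative of_real (1 - (cmod a)\<^sup>2)) (at 0)"
    using has_field_derivative_Moebius_function[of "-a" 0] by simp
  have nz: "1 - cnj (u a) * u a = of_real (1 - (cmod (u a))\<^sup>2)"
    by (metis complex_norm_square mult.commute of_real_1 of_real_diff)
  have pos: "0 < 1 - (cmod (u a))\<^sup>2"
    using ua by (simp add: abs_square_less_1)
  have dM: "(?M (u a) has_field_derivative 1 / of_real (1 - (cmod (u a))\<^sup>2)) (at (u a))"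
    using has_field_derivative_Moebius_function[of "u a" "u a"] pos unfolding nz
    by (simp add: power2_eq_square del: of_real_diff of_real_mult)
  have "(u \<circ> ?M (-a) has_field_derivative deriv u a * of_real (1 - (cmod a)\<^sup>2)) (at 0)"
    by (rule DERIV_chain) (use du dM0 in \<open>simp_all add: Moebius_function_of_zero\<close>)
  then have "(k has_field_derivative
      1 / of_real (1 - (cmod (u a))\<^sup>2) * (deriv u a * of_real (1 - (cmod a)\<^sup>2))) (at 0)"
    unfolding k_def by (rule DERIV_chain[rotated]) (use dM in \<open>simp add: Moebius_function_of_zero\<close>)
  then have "deriv k 0 = 1 / of_real (1 - (cmod (u a))\<^sup>2) * (deriv u a * of_real (1 - (cmod a)\<^sup>2))"
    by (rule DERIV_imp_deriv)
  moreover have "cmod (deriv k 0) \<le> 1"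
    by (rule Schwarz_Lemma(2)[OF hol k0 kdisk, of 0]) auto
  moreover have "\<bar>1 - (cmod a)\<^sup>2\<bar> = 1 - (cmod a)\<^sup>2" "\<bar>1 - (cmod (u a))\<^sup>2\<bar> = 1 - (cmod (u a))\<^sup>2"
    using ua by (simp_all add: abs_square_le_1)
  ultimately show ?deriv
    using pos by (simp add: norm_divide norm_mult del: of_real_diff of_real_power)
qed

text \<open>The form for maps into the closed disk covers the unimodular constants, which do occur as osculating
  poles: for a Moebius map onto a half plane the osculating pole is a constant on the circle.\<close>

lemma Schwarz_Pick_derivative_closed:
  assumes u: "u holomorphic_on unit_disk" "u \<in> unit_disk \<rightarrow> cball 0 1" and z: "z \<in> unit_disk"
  shows "cmod (deriv u z) * (1 - (cmod z)\<^sup>2) \<le> 1 - (cmod (u z))\<^sup>2"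
proof -
  \<comment> \<open>The functions r u with r < 1 map into the open disk; then r tends to 1.\<close>
  let ?f = "\<lambda>r. r * cmod (deriv u z) * (1 - (cmod z)\<^sup>2)" and ?g = "\<lambda>r. 1 - (r * cmod (u z))\<^sup>2"
  have "?f r \<le> ?g r" if "0 < r" "r < 1" for r :: real
  proof -
    have "r * cmod (u w) < 1" if "cmod w < 1" for w
    proof -
      have "cmod (u w) \<le> 1"
        using u(2) that by (auto simp: Pi_iff)
      then have "r * cmod (u w) \<le> r * 1"
        using \<open>0 < r\<close> by (intro mult_left_mono) auto
      with \<open>r < 1\<close> show ?thesis by simp
    qed
    then have "(\<lambda>w. of_real r * u w) \<in> unit_disk \<rightarrow> unit_disk"
      using that by (auto simp: norm_mult)
    from Schwarz_Pick(2)[OF _ this z]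
    have "cmod (deriv (\<lambda>w. of_real r * u w) z) * (1 - (cmod z)\<^sup>2) \<le> 1 - (cmod (of_real r * u z))\<^sup>2"
      using u(1) z by (simp add: holomorphic_intros)
    moreover have "deriv (\<lambda>w. of_real r * u w) z = of_real r * deriv u z"
      by (rule deriv_cmult) (use u z in \<open>auto intro: holomorphic_on_imp_differentiable_at\<close>)
    ultimately show ?thesis
      using that by (simp add: norm_mult)
  qed
  then have "eventually (\<lambda>r. ?f r \<le> ?g r) (at_left 1)"
    unfolding eventually_at_left_field by (intro exI[of _ 0]) auto
  moreover have "(?f \<longlongrightarrow> 1 * cmod (deriv u z) * (1 - (cmod z)\<^sup>2)) (at_left 1)"
    by (intro tendsto_intros)
  moreover have "(?g \<longlongrightarrow> 1 - (1 * cmod (u z))\<^sup>2) (at_left 1)"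
    by (intro tendsto_intros)
  ultimately show ?thesis
    using tendsto_le[of "at_left (1::real)" ?g _ ?f] by fastforce
qed

lemma subordination:
  assumes j: "j holomorphic_on unit_disk" "inj_on j unit_disk"
    and G: "G holomorphic_on unit_disk" "G ` unit_disk \<subseteq> j ` unit_disk" "G 0 = j 0"
  obtains \<sigma> where "\<sigma> holomorphic_on unit_disk" "\<sigma> \<in> unit_disk \<rightarrow> unit_disk" "\<sigma> 0 = 0"
    "\<And>z. z \<in> unit_disk \<Longrightarrow> G z = j (\<sigma> z)" "deriv G 0 = deriv j 0 * deriv \<sigma> 0"
    "cmod (deriv \<sigma> 0) \<le> 1" "cmod (deriv G 0) \<le> cmod (deriv j 0)"
proof -
  obtain ji where ji: "ji holomorphic_on j ` unit_disk" "\<And>z. z \<in> unit_disk \<Longrightarrow> ji (j z) = z"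
    using holomorphic_has_inverse[OF j(1) open_ball j(2)] by metis
  define \<sigma> where "\<sigma> z = ji (G z)" for z
  have G_j: "G z = j (\<sigma> z)" "\<sigma> z \<in> unit_disk" if z: "z \<in> unit_disk" for z
  proof -
    obtain w where "w \<in> unit_disk" "G z = j w"
      using G(2) z by blast
    then show "G z = j (\<sigma> z)" "\<sigma> z \<in> unit_disk"
      using ji(2) by (simp_all add: \<sigma>_def)
  qed
  have hol: "\<sigma> holomorphic_on unit_disk"
    using holomorphic_on_compose_gen[OF G(1) ji(1) G(2)] by (simp add: \<sigma>_def[abs_def] o_def)
  have \<sigma>0: "\<sigma> 0 = 0"
    using ji(2)[of 0] G(3) by (simp add: \<sigma>_def)
  have disk: "cmod (\<sigma> z) < 1" if "cmod z < 1" for z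
    using G_j(2)[of z] that by simp
  have le_1: "cmod (deriv \<sigma> 0) \<le> 1"
    by (rule Schwarz_Lemma(2)[OF hol \<sigma>0 disk, of 0]) auto
  have "((\<lambda>z. j (\<sigma> z)) has_field_derivative deriv j 0 * deriv \<sigma> 0) (at 0)"
    by (rule DERIV_chain2[where g = \<sigma>])
      (use holomorphic_derivI[OF j(1) open_ball] holomorphic_derivI[OF hol open_ball] \<sigma>0 in auto)
  moreover have "eventually (\<lambda>z. z \<in> unit_disk) (nhds 0)"
    by (intro eventually_nhds_in_open) auto
  then have "eventually (\<lambda>z. G z = j (\<sigma> z)) (nhds 0)"
    by eventually_elim (rule G_j(1))
  ultimately have dG: "deriv G 0 = deriv j 0 * deriv \<sigma> 0"
    by (simp add: deriv_cong_ev DERIV_imp_deriv)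
  have "cmod (deriv G 0) \<le> cmod (deriv j 0)"
    unfolding dG norm_mult using le_1 by (simp add: mult_left_le)
  with hol G_j \<sigma>0 dG le_1 that show thesis
    by blast
qed

text \<open>A self-map of the disk that fixes \<open>0\<close> is \<open>z q(z)\<close>, its second derivative at \<open>0\<close> is \<open>2 q'(0)\<close>, and
  Schwarz-Pick applies to \<open>q\<close>. If the first derivative is nearly unimodular, then the second one is
  nearly \<open>0\<close>.\<close>

lemma second_coefficient_bound:
  assumes \<sigma>: "\<sigma> holomorphic_on unit_disk" "\<sigma> \<in> unit_disk \<rightarrow> unit_disk" "\<sigma> 0 = 0"
  shows "cmod (deriv (deriv \<sigma>) 0) \<le> 2 * (1 - (cmod (deriv \<sigma> 0))\<^sup>2)"
proof -
  obtain q where q: "q holomorphic_on unit_disk" "\<And>z. cmod z < 1 \<Longrightarrow> \<sigma> z = z * q z" "deriv \<sigma> 0 = q 0"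
    using Schwarz3[OF \<sigma>(1,3)] by blast
  have disk: "cmod (\<sigma> z) < 1" if "cmod z < 1" for z
    using \<sigma>(2) that by (auto simp: Pi_iff)
  have "cmod (q z) \<le> 1" if z: "cmod z < 1" for z
  proof (cases "z = 0")
    case True
    then show ?thesis
      using Schwarz_Lemma(2)[OF \<sigma>(1,3) disk, of 0] q(3) by simp
  next
    case False
    have "cmod z * cmod (q z) \<le> cmod z"
      using Schwarz_Lemma(1)[OF \<sigma>(1,3) disk z] q(2)[OF z] by (simp add: norm_mult)
    with False show ?thesis
      by simp
  qed
  then have "q \<in> unit_disk \<rightarrow> cball 0 1"
    by auto
  from Schwarz_Pick_derivative_closed[OF q(1) this, of 0]
  have bound: "cmod (deriv q 0) \<le> 1 - (cmod (q 0))\<^sup>2"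
    by simp
  have ev_disk: "eventually (\<lambda>z. z \<in> unit_disk) (nhds 0)"
    by (intro eventually_nhds_in_open) auto
  then have "eventually (\<lambda>z. deriv \<sigma> z = q z + z * deriv q z) (nhds 0)"
  proof eventually_elim
    case (elim z)
    have "((\<lambda>z. z * q z) has_field_derivative q z + z * deriv q z) (at z)"
      using holomorphic_derivI[OF q(1) open_ball elim] by (auto intro!: derivative_eq_intros)
    moreover have "eventually (\<lambda>z. z \<in> unit_disk) (nhds z)"
      using elim by (intro eventually_nhds_in_open) auto
    then have "eventually (\<lambda>z. \<sigma> z = z * q z) (nhds z)"
      by eventually_elim (simp add: q(2))
    ultimately show ?case
      by (simp add: deriv_cong_ev DERIV_imp_deriv)
  qed
  then have "deriv (deriv \<sigma>) 0 = deriv (\<lambda>z. q z + z * deriv q z) 0"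
    by (rule deriv_cong_ev) simp
  also have "((\<lambda>z. q z + z * deriv q z) has_field_derivative 2 * deriv q 0) (at 0)"
    using holomorphic_derivI[OF q(1) open_ball, of 0]
      holomorphic_derivI[OF holomorphic_deriv[OF q(1) open_ball] open_ball, of 0]
    by (auto intro!: derivative_eq_intros)
  then have "deriv (\<lambda>z. q z + z * deriv q z) 0 = 2 * deriv q 0"
    by (rule DERIV_imp_deriv)
  finally show ?thesis
    using bound q(3) by (simp add: norm_mult)
qed

text \<open>The quantity \<open>A\<^sub>f\<close> at \<open>b\<close> is, up to the factor \<open>2\<close>, the pre-Schwarzian at \<open>0\<close> after \<open>b\<close> has been
  moved to \<open>0\<close>. This explains its form and reduces statements about it to the origin.\<close>

lemma pre_schwarzian_disk_automorphism:
  assumes f: "f analytic_on {b}" "deriv f b \<noteq> 0" and b: "cmod b < 1"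
  shows "pre_schwarzian (\<lambda>z. f (Moebius_function 0 (- b) z)) 0 = 2 * A_op f b"
proof -
  define T where "T z = (1 * z + b) / (cnj b * z + 1)" for z
  have T: "Moebius_function 0 (- b) = T"
    by (rule ext) (simp add: T_def Moebius_function_simple)
  have nz: "cnj b * 0 + 1 \<noteq> 0"
    by simp
  have det: "1 * 1 - b * cnj b = of_real (1 - (cmod b)\<^sup>2)"
    by (metis complex_norm_square of_real_1 of_real_diff mult_1)
  have det_nz: "1 * 1 - b * cnj b \<noteq> 0"
    unfolding det using b by (simp only: of_real_eq_0_iff) (simp add: abs_square_eq_1)
  have T0: "T 0 = b"
    by (simp add: T_def)
  have dT: "deriv T 0 = of_real (1 - (cmod b)\<^sup>2)"
    using moebius_map_has_field_derivative[OF nz, of 1 b] unfolding det T_def[abs_def, symmetric]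
    by (simp add: DERIV_imp_deriv)
  have pT: "pre_schwarzian T 0 = - 2 * cnj b"
    using pre_schwarzian_moebius_map[OF nz det_nz] unfolding T_def[abs_def, symmetric] by simp
  have "pre_schwarzian (\<lambda>z. f (T z)) 0 = pre_schwarzian f (T 0) * deriv T 0 + pre_schwarzian T 0"
  proof (rule pre_schwarzian_compose)
    show "T analytic_on {0}"
      using moebius_map_analytic[OF nz] unfolding T_def[abs_def] .
    show "deriv T 0 \<noteq> 0"
      using dT det det_nz by simp
  qed (simp_all add: T0 f)
  then show ?thesis
    by (simp add: T T0 dT pT A_op_def algebra_simps)
qed

section \<open>The pole of the osculating Moebius transformation\<close>

text \<open>A Moebius transformation with pole \<open>s\<close> has pre-Schwarzian \<open>2 / (s - z)\<close>; solving for \<open>s\<close> gives the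
  pole of the transformation that has the same derivatives as \<open>f\<close> up to order two at \<open>z\<close>.\<close>

definition osculating_pole :: "(complex \<Rightarrow> complex) \<Rightarrow> complex \<Rightarrow> complex"
  where "osculating_pole f z = z + 2 / pre_schwarzian f z"

lemma A_op_osculating_pole:
  assumes "pre_schwarzian f z \<noteq> 0"
  shows "A_op f z * (osculating_pole f z - z) = 1 - cnj z * osculating_pole f z"
proof -
  have "of_real (1 - (cmod z)\<^sup>2) = 1 - z * cnj z"
    by (metis complex_norm_square of_real_1 of_real_diff)
  with assms show ?thesis
    unfolding A_op_def osculating_pole_def by (simp add: field_simps)
qed

text \<open>An osculating transformation that is affine has its pole at infinity; then \<open>A\<^sub>f = - cnj z\<close>.\<close>

lemma cmod_A_op_less_1:
  assumes "z \<in> unit_disk" "pre_schwarzian f z = 0"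
  shows "cmod (A_op f z) < 1"
  using assms by (simp add: A_op_def)

lemma cmod_A_op_ge_1_iff:
  assumes "z \<in> unit_disk" "pre_schwarzian f z \<noteq> 0"
  shows "1 \<le> cmod (A_op f z) \<longleftrightarrow> cmod (osculating_pole f z) \<le> 1"
proof -
  let ?s = "osculating_pole f z"
  have s: "cmod (?s - z) > 0"
    using assms by (simp add: osculating_pole_def)
  have "1 \<le> cmod (A_op f z) \<longleftrightarrow> (cmod (?s - z))\<^sup>2 \<le> (cmod (A_op f z * (?s - z)))\<^sup>2"
    using s by (simp add: norm_mult)
  also have "\<dots> \<longleftrightarrow> 0 \<le> (1 - (cmod z)\<^sup>2) * (1 - (cmod ?s)\<^sup>2)"
    unfolding A_op_osculating_pole[OF assms(2)] cmod_moebius_identity[of z ?s, symmetric] by linarith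
  also have "\<dots> \<longleftrightarrow> 0 \<le> 1 - (cmod ?s)\<^sup>2"
    using one_minus_cmod_square_pos[OF assms(1)] by (simp add: zero_le_mult_iff)
  also have "\<dots> \<longleftrightarrow> cmod ?s \<le> 1"
    by (simp add: abs_square_le_1)
  finally show ?thesis .
qed

lemma holomorphic_on_pre_schwarzian:
  assumes "f holomorphic_on S" "open S" "\<And>z. z \<in> S \<Longrightarrow> deriv f z \<noteq> 0"
  shows "pre_schwarzian f holomorphic_on S"
  unfolding pre_schwarzian_def
  using assms by (auto intro!: holomorphic_intros)

text \<open>The Schwarzian measures how fast the osculating transformation changes.\<close>

lemma schwarzian_osculating_pole:
  assumes "pre_schwarzian f holomorphic_on S" "open S" "z \<in> S" and nz: "pre_schwarzian f z \<noteq> 0"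
  shows "schwarzian f z * (osculating_pole f z - z)\<^sup>2 = - 2 * deriv (osculating_pole f) z"
proof -
  have "(pre_schwarzian f has_field_derivative deriv (pre_schwarzian f) z) (at z)"
    using assms by (simp add: holomorphic_derivI)
  then have "((\<lambda>z. z + 2 / pre_schwarzian f z) has_field_derivative
      1 - 2 * deriv (pre_schwarzian f) z / (pre_schwarzian f z)\<^sup>2) (at z)"
    using nz by (auto intro!: derivative_eq_intros simp: field_simps power2_eq_square)
  then have deriv_eq: "deriv (osculating_pole f) z = 1 - 2 * deriv (pre_schwarzian f) z / (pre_schwarzian f z)\<^sup>2"
    unfolding osculating_pole_def by (rule DERIV_imp_deriv)
  show ?thesis
    unfolding deriv_eq schwarzian_def osculating_pole_def
    using nz by (simp add: field_simps power2_eq_square)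
qed

lemma holomorphic_on_osculating_pole:
  assumes "pre_schwarzian f holomorphic_on S" "\<And>z. z \<in> S \<Longrightarrow> pre_schwarzian f z \<noteq> 0"
  shows "osculating_pole f holomorphic_on S"
  unfolding osculating_pole_def using assms by (auto intro!: holomorphic_intros)

text \<open>From left to right the term with the Schwarzian is dropped. Conversely, if the osculating pole is a
  map of the disk into its closure, then the inequality is Schwarz-Pick for this map, multiplied by
  \<open>2 (1 - \<bar>z\<bar>\<^sup>2) / \<bar>\<psi> - z\<bar>\<^sup>2\<close>.\<close>

theorem schwarzian_bound_iff_A_op_ge_1:
  assumes f: "f holomorphic_on unit_disk" and nz: "\<And>z. z \<in> unit_disk \<Longrightarrow> deriv f z \<noteq> 0"
  shows "(\<forall>z\<in>unit_disk. cmod (schwarzian f z) * (1 - (cmod z)\<^sup>2)\<^sup>2 + 2 \<le> 2 * (cmod (A_op f z))\<^sup>2)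
     \<longleftrightarrow> (\<forall>z\<in>unit_disk. 1 \<le> cmod (A_op f z))" (is "?L \<longleftrightarrow> ?R")
proof
  assume ?L
  show ?R
  proof
    fix z assume "z \<in> unit_disk"
    with \<open>?L\<close> have "cmod (schwarzian f z) * (1 - (cmod z)\<^sup>2)\<^sup>2 + 2 \<le> 2 * (cmod (A_op f z))\<^sup>2"
      by blast
    moreover have "0 \<le> cmod (schwarzian f z) * (1 - (cmod z)\<^sup>2)\<^sup>2"
      by simp
    ultimately have "1\<^sup>2 \<le> (cmod (A_op f z))\<^sup>2"
      unfolding power_one by linarith
    then show "1 \<le> cmod (A_op f z)"
      by (rule power2_le_imp_le) simp
  qed
next
  assume ?R
  then have p: "pre_schwarzian f z \<noteq> 0" if "z \<in> unit_disk" for z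
    using cmod_A_op_less_1[OF that] that linorder_not_less by blast
  have holp: "pre_schwarzian f holomorphic_on unit_disk"
    using f nz by (intro holomorphic_on_pre_schwarzian) auto
  show ?L
  proof
    fix z assume z: "z \<in> unit_disk"
    let ?s = "osculating_pole f z"
    have s: "0 < (cmod (?s - z))\<^sup>2"
      using p[OF z] by (simp add: osculating_pole_def)
    have pos: "0 < 1 - (cmod z)\<^sup>2"
      by (rule one_minus_cmod_square_pos[OF z])
    have "cmod (deriv (osculating_pole f) z) * (1 - (cmod z)\<^sup>2) \<le> 1 - (cmod ?s)\<^sup>2"
      using \<open>?R\<close> p holp z cmod_A_op_ge_1_iff
      by (intro Schwarz_Pick_derivative_closed holomorphic_on_osculating_pole) auto
    then have "2 * (cmod (deriv (osculating_pole f) z) * (1 - (cmod z)\<^sup>2)) * (1 - (cmod z)\<^sup>2)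
        \<le> 2 * (1 - (cmod ?s)\<^sup>2) * (1 - (cmod z)\<^sup>2)"
      using pos by (intro mult_right_mono mult_left_mono) auto
    also have "\<dots> = 2 * ((cmod (A_op f z * (?s - z)))\<^sup>2 - (cmod (?s - z))\<^sup>2)"
      using A_op_osculating_pole[OF p[OF z]] cmod_moebius_identity[of z ?s] by simp
    finally have "cmod (2 * deriv (osculating_pole f) z) * (1 - (cmod z)\<^sup>2)\<^sup>2
        \<le> 2 * ((cmod (A_op f z))\<^sup>2 * (cmod (?s - z))\<^sup>2 - (cmod (?s - z))\<^sup>2)"
      by (simp add: norm_mult power_mult_distrib power2_eq_square mult_ac)
    moreover have deriv_eq: "cmod (2 * deriv (osculating_pole f) z) = cmod (schwarzian f z) * (cmod (?s - z))\<^sup>2"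
      using arg_cong[OF schwarzian_osculating_pole[OF holp open_ball z p[OF z]], of cmod]
      by (simp add: norm_mult norm_power)
    ultimately have "(cmod (schwarzian f z) * (1 - (cmod z)\<^sup>2)\<^sup>2 + 2) * (cmod (?s - z))\<^sup>2
        \<le> (2 * (cmod (A_op f z))\<^sup>2) * (cmod (?s - z))\<^sup>2"
      unfolding deriv_eq by (simp add: algebra_simps)
    then show "cmod (schwarzian f z) * (1 - (cmod z)\<^sup>2)\<^sup>2 + 2 \<le> 2 * (cmod (A_op f z))\<^sup>2"
      using s by (simp only: mult_le_cancel_right_pos)
  qed
qed

section \<open>The boundary point of a fixed-point free self-map\<close>

text \<open>Wolff's lemma, in the form that every horodisk at \<open>\<zeta>\<close> is mapped into its closure.\<close>

lemma Wolff_boundary_point: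
  assumes u: "u holomorphic_on unit_disk" "u \<in> unit_disk \<rightarrow> cball 0 1"
    and nofix: "\<And>z. z \<in> unit_disk \<Longrightarrow> u z \<noteq> z"
  obtains \<zeta> where "cmod \<zeta> = 1"
    "\<And>z. z \<in> unit_disk \<Longrightarrow>
       (1 - (cmod z)\<^sup>2) * (cmod (\<zeta> - u z))\<^sup>2 \<le> (1 - (cmod (u z))\<^sup>2) * (cmod (\<zeta> - z))\<^sup>2"
proof -
  \<comment> \<open>The contractions r u with r < 1 have fixed points in the disk by Brouwer; the boundary point is a
    limit of these fixed points as r tends to 1.\<close>
  define r :: "nat \<Rightarrow> real" where "r n = 1 - 1 / real (n + 2)" for n
  have r: "0 < r n" "r n < 1" for n
    by (auto simp: r_def field_simps)
  have r_lim: "r \<longlonglongrightarrow> 1"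
    unfolding r_def by real_asymp
  have cont: "continuous_on unit_disk u"
    by (rule holomorphic_on_imp_continuous_on[OF u(1)])
  have small: "cmod (of_real (r n) * u z) \<le> r n" if "z \<in> unit_disk" for n z
  proof -
    have "cmod (u z) \<le> 1"
      using u(2) that by (auto simp: Pi_iff)
    then show ?thesis
      using r[of n] by (simp add: norm_mult mult_left_le)
  qed
  have "\<exists>z. z \<in> cball 0 (r n) \<and> of_real (r n) * u z = z" for n
  proof -
    have sub: "cball 0 (r n) \<subseteq> unit_disk"
      using r[of n] by auto
    have "continuous_on (cball 0 (r n)) (\<lambda>z. of_real (r n) * u z)"
      by (intro continuous_intros continuous_on_subset[OF cont sub])
    moreover have "(\<lambda>z. of_real (r n) * u z) \<in> cball 0 (r n) \<rightarrow> cball 0 (r n)"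
      using small sub by auto
    ultimately show ?thesis
      using brouwer[of "cball 0 (r n)" "\<lambda>z. of_real (r n) * u z"] r[of n] by (metis less_imp_le cball_eq_empty compact_cball convex_cball not_less)
  qed
  then obtain b where b: "\<And>n. b n \<in> cball 0 (r n)" "\<And>n. of_real (r n) * u (b n) = b n"
    by metis
  have b1: "b n \<in> unit_disk" for n
    using b(1)[of n] r[of n] by auto
  then have "b n \<in> cball 0 1" for n
    by (meson ball_subset_cball subsetD)
  then obtain \<zeta> \<rho> where \<zeta>: "\<zeta> \<in> cball 0 1" and \<rho>: "strict_mono (\<rho> :: nat \<Rightarrow> nat)" and lim: "(b \<circ> \<rho>) \<longlonglongrightarrow> \<zeta>"
    using compact_cball[of "0::complex" 1] unfolding compact_def by metis
  have r_lim': "(\<lambda>n. r (\<rho> n)) \<longlonglongrightarrow> 1"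
    using LIMSEQ_subseq_LIMSEQ[OF r_lim \<rho>] by (simp add: o_def)
  have b_lim: "(\<lambda>n. b (\<rho> n)) \<longlonglongrightarrow> \<zeta>"
    using lim by (simp add: o_def)
  \<comment> \<open>A limit inside the disk would be a fixed point of u.\<close>
  have "\<zeta> \<notin> unit_disk"
  proof
    assume in_disk: "\<zeta> \<in> unit_disk"
    then have "isCont u \<zeta>"
      using cont continuous_on_eq_continuous_at by blast
    then have "(\<lambda>n. of_real (r (\<rho> n)) * u (b (\<rho> n))) \<longlonglongrightarrow> of_real 1 * u \<zeta>"
      by (intro tendsto_intros r_lim' isCont_tendsto_compose[OF _ b_lim])
    then have "(\<lambda>n. b (\<rho> n)) \<longlonglongrightarrow> u \<zeta>"
      by (simp add: b(2))
    then have "u \<zeta> = \<zeta>"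
      using b_lim LIMSEQ_unique by blast
    with nofix in_disk show False
      by blast
  qed
  with \<zeta> have norm_\<zeta>: "cmod \<zeta> = 1"
    by auto
  have "(1 - (cmod z)\<^sup>2) * (cmod (\<zeta> - u z))\<^sup>2 \<le> (1 - (cmod (u z))\<^sup>2) * (cmod (\<zeta> - z))\<^sup>2"
    if z: "z \<in> unit_disk" for z
  proof -
    have flip: "cmod (1 - cnj \<zeta> * s) = cmod (\<zeta> - s)" for s
    proof -
      have "\<zeta> * cnj \<zeta> = 1"
        using norm_\<zeta> by (simp add: complex_norm_square[symmetric])
      then have "\<zeta> * (1 - cnj \<zeta> * s) = \<zeta> - s"
        by (simp add: algebra_simps)
      then show ?thesis
        using norm_\<zeta> by (metis mult_1 norm_mult)
    qed
    define v where "v n = of_real (r (\<rho> n)) * u z" for n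
    have key: "(1 - (cmod z)\<^sup>2) * (cmod (1 - cnj (b (\<rho> n)) * v n))\<^sup>2
        \<le> (1 - (cmod (v n))\<^sup>2) * (cmod (1 - cnj (b (\<rho> n)) * z))\<^sup>2" for n
    proof -
      let ?b = "b (\<rho> n)" and ?u = "\<lambda>z. of_real (r (\<rho> n)) * u z"
      have vn: "cmod (v n) < 1" and zb: "cmod z < 1" "cmod ?b < 1"
        using small[OF z, of "\<rho> n"] r[of "\<rho> n"] z b1[of "\<rho> n"] by (auto simp: v_def)
      have "?u \<in> unit_disk \<rightarrow> unit_disk"
        using small r le_less_trans by fastforce
      \<comment> \<open>The Schwarz-Pick inequality at the fixed point says that pseudo-hyperbolic disks around it are
        mapped into themselves; in the limit they become horodisks.\<close>
      from Schwarz_Pick(1)[OF _ this b1[of "\<rho> n"] z]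
      have le: "cmod (Moebius_function 0 ?b (v n)) \<le> cmod (Moebius_function 0 ?b z)"
        using u(1) b(2)[of "\<rho> n"] by (simp add: holomorphic_intros v_def)
      have nz: "1 - cnj ?b * s \<noteq> 0" if "cmod s < 1" for s
        using norm_mult_less[of "cnj ?b" 1 s 1] that zb by auto
      have pos: "0 < 1 - (cmod ?b)\<^sup>2"
        by (rule one_minus_cmod_square_pos[OF b1])
      have "1 - (cmod (Moebius_function 0 ?b z))\<^sup>2 \<le> 1 - (cmod (Moebius_function 0 ?b (v n)))\<^sup>2"
        using le by (simp add: power_mono)
      then have "(1 - (cmod ?b)\<^sup>2) * ((1 - (cmod z)\<^sup>2) / (cmod (1 - cnj ?b * z))\<^sup>2)
          \<le> (1 - (cmod ?b)\<^sup>2) * ((1 - (cmod (v n))\<^sup>2) / (cmod (1 - cnj ?b * v n))\<^sup>2)"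
        using one_minus_cmod_Moebius_function zb vn by simp
      then have "(1 - (cmod z)\<^sup>2) / (cmod (1 - cnj ?b * z))\<^sup>2
          \<le> (1 - (cmod (v n))\<^sup>2) / (cmod (1 - cnj ?b * v n))\<^sup>2"
        using pos by (simp only: mult_le_cancel_left_pos)
      then show ?thesis
        using nz[OF vn] nz[OF zb(1)] by (simp add: frac_le_eq divide_le_0_iff pos_divide_le_eq pos_le_divide_eq mult_ac)
    qed
    have v_lim: "v \<longlonglongrightarrow> of_real 1 * u z"
      unfolding v_def by (intro tendsto_intros r_lim')
    have "(\<lambda>n. (1 - (cmod z)\<^sup>2) * (cmod (1 - cnj (b (\<rho> n)) * v n))\<^sup>2) \<longlonglongrightarrow>
        (1 - (cmod z)\<^sup>2) * (cmod (1 - cnj \<zeta> * (of_real 1 * u z)))\<^sup>2"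
      by (intro tendsto_intros b_lim v_lim)
    moreover have "(\<lambda>n. (1 - (cmod (v n))\<^sup>2) * (cmod (1 - cnj (b (\<rho> n)) * z))\<^sup>2) \<longlonglongrightarrow>
        (1 - (cmod (of_real 1 * u z))\<^sup>2) * (cmod (1 - cnj \<zeta> * z))\<^sup>2"
      by (intro tendsto_intros b_lim v_lim)
    ultimately have "(1 - (cmod z)\<^sup>2) * (cmod (1 - cnj \<zeta> * (of_real 1 * u z)))\<^sup>2
        \<le> (1 - (cmod (of_real 1 * u z))\<^sup>2) * (cmod (1 - cnj \<zeta> * z))\<^sup>2"
      by (rule LIMSEQ_le) (use key in blast)
    then show ?thesis
      by (simp add: flip)
  qed
  with norm_\<zeta> that show thesis
    by blast
qed

section \<open>Second-order conditions at a maximum\<close>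

lemma Re_local_max_second_order:
  assumes k: "k analytic_on {0}"
    and max: "eventually (\<lambda>s::real. Re (k (of_real s)) \<le> Re (k 0)) (nhds 0)"
  shows "Re (deriv k 0) = 0" and "Re (deriv (deriv k) 0) \<le> 0"
proof -
  define m m' where "m s = Re (k (of_real s))" and "m' s = Re (deriv k (of_real s))" for s :: real
  have of_real_lim: "filterlim complex_of_real (nhds 0) (nhds 0)"
    using tendsto_of_real[OF filterlim_ident, of 0] by simp
  have "eventually (\<lambda>w. k analytic_on {w}) (nhds 0)"
    by (rule eventually_analytic_at[OF k])
  then have "eventually (\<lambda>s::real. k analytic_on {of_real s}) (nhds 0)"
    using of_real_lim by (rule eventually_compose_filterlim)
  then have ev: "eventually (\<lambda>s. (m has_real_derivative m' s) (at s) \<and> m s \<le> m 0) (nhds 0)"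
    using max
  proof eventually_elim
    case (elim s)
    have "((\<lambda>s. k (complex_of_real s)) has_vector_derivative deriv k (of_real s)) (at s)"
      using elim(1) by (intro has_vector_derivative_real_field) (simp add: analytic_derivI)
    then have "(m has_real_derivative m' s) (at s)"
      unfolding m_def[abs_def] m'_def by (rule has_field_derivative_Re)
    with elim(2) show ?case
      by (simp add: m_def)
  qed
  then obtain e where e: "e > 0"
    "\<And>s. \<bar>s\<bar> < e \<Longrightarrow> (m has_real_derivative m' s) (at s)" "\<And>s. \<bar>s\<bar> < e \<Longrightarrow> m s \<le> m 0"
    unfolding eventually_nhds_metric dist_real_def by auto
  have m'0: "m' 0 = 0"
    by (rule DERIV_local_max[OF e(2) e(1)]) (use e in auto)
  then show "Re (deriv k 0) = 0"
    by (simp add: m'_def)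
  show "Re (deriv (deriv k) 0) \<le> 0"
  proof (rule ccontr)
    assume "\<not> ?thesis"
    then have pos: "0 < Re (deriv (deriv k) 0)"
      by simp
    have "((\<lambda>s. deriv k (complex_of_real s)) has_vector_derivative deriv (deriv k) (of_real 0)) (at 0)"
      using k by (intro has_vector_derivative_real_field) (simp add: analytic_derivI analytic_deriv)
    from has_field_derivative_Re[OF this] have "(m' has_real_derivative Re (deriv (deriv k) 0)) (at 0)"
      by (simp add: m'_def[abs_def])
    from DERIV_pos_inc_right[OF this pos]
    obtain d where d: "d > 0" "\<And>h. 0 < h \<Longrightarrow> h < d \<Longrightarrow> 0 < m' h"
      unfolding m'0 add_0 by blast
    define s where "s = min d e / 2"
    have s: "0 < s" "s < d" "s < e"
      using d(1) e(1) by (auto simp: s_def)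
    obtain x where "0 < x" "x < s" "m s - m 0 = s * m' x"
      using MVT2[of 0 s m m'] e(2) s by auto
    moreover have "m s \<le> m 0"
      using e(3) s by simp
    ultimately show False
      using mult_pos_pos[of s "m' x"] d(2)[of x] s by linarith
  qed
qed

text \<open>For use at a maximum of \<open>Re g\<close> along a line: there the first derivative \<open>d / F'\<close> is purely
  imaginary, its square is negative, and so the real part of the second derivative has the sign of the
  real part of the pre-Schwarzian.\<close>

lemma deriv2_inverse_along_line:
  fixes F g :: "complex \<Rightarrow> complex" and w d :: complex
  assumes F: "F analytic_on {w}" "deriv F w \<noteq> 0"
    and g: "g analytic_on {F w}" "eventually (\<lambda>a. F (g a) = a) (nhds (F w))" "g (F w) = w"
  defines "k \<equiv> \<lambda>s. g (F w + s * d)"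
  shows "deriv k 0 = d / deriv F w"
    and "deriv (deriv k) 0 = - pre_schwarzian F w * (d / deriv F w)\<^sup>2"
proof -
  have dg: "deriv F w * deriv g (F w) = 1"
  proof -
    have "((\<lambda>a. F (g a)) has_field_derivative deriv F w * deriv g (F w)) (at (F w))"
      by (rule DERIV_chain2[where g = g]) (use F g in \<open>simp_all add: analytic_derivI\<close>)
    then have "((\<lambda>a. a) has_field_derivative deriv F w * deriv g (F w)) (at (F w))"
      using g(2) DERIV_cong_ev[OF refl _ refl, of "\<lambda>a. F (g a)" "\<lambda>a. a" "F w"] by simp
    then show ?thesis
      using DERIV_ident DERIV_unique by blast
  qed
  have pre_g: "pre_schwarzian g (F w) = - pre_schwarzian F w * deriv g (F w)"
  proof -
    have "pre_schwarzian (\<lambda>a. F (g a)) (F w) = pre_schwarzian F w * deriv g (F w) + pre_schwarzian g (F w)"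
      using pre_schwarzian_compose[of F g "F w"] F(1,2) g(1,3) dg by (metis mult_zero_right zero_neq_one)
    moreover have "eventually (\<lambda>a. eventually (\<lambda>a. F (g a) = a) (nhds a)) (nhds (F w))"
      using g(2) by (simp only: eventually_eventually)
    then have "eventually (\<lambda>a. deriv (\<lambda>a. F (g a)) a = deriv (\<lambda>a. a) a) (nhds (F w))"
      by eventually_elim (rule deriv_cong_ev, auto)
    then have "deriv (deriv (\<lambda>a. F (g a))) (F w) = deriv (deriv (\<lambda>a. a)) (F w)"
      by (rule deriv_cong_ev) simp
    then have "pre_schwarzian (\<lambda>a. F (g a)) (F w) = 0"
      by (simp add: pre_schwarzian_def)
    ultimately show ?thesis
      by (simp add: add_eq_0_iff)
  qed
  have "deriv (deriv g) (F w) = - pre_schwarzian F w * (deriv g (F w))\<^sup>2"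
  proof -
    have "deriv g (F w) \<noteq> 0"
      using dg by auto
    then have "deriv (deriv g) (F w) = pre_schwarzian g (F w) * deriv g (F w)"
      by (simp add: pre_schwarzian_def)
    then show ?thesis
      unfolding pre_g by (simp add: power2_eq_square)
  qed
  moreover have dg': "deriv g (F w) = 1 / deriv F w"
    using dg F(2) by (simp add: field_simps)
  moreover have kderiv: "eventually (\<lambda>s. deriv k s = deriv g (F w + s * d) * d) (nhds 0)"
  proof -
    have "filterlim (\<lambda>s. F w + s * d) (nhds (F w)) (nhds 0)"
      by (auto intro!: tendsto_eq_intros filterlim_ident)
    with eventually_analytic_at[OF g(1)] have "eventually (\<lambda>s. g analytic_on {F w + s * d}) (nhds 0)"
      by (rule eventually_compose_filterlim)
    then show ?thesis
    proof eventually_elim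
      case (elim s)
      have "((\<lambda>s. F w + s * d) has_field_derivative d) (at s)"
        by (auto intro!: derivative_eq_intros)
      with elim show ?case
        unfolding k_def by (intro DERIV_imp_deriv DERIV_chain2[where g = "\<lambda>s. F w + s * d"] analytic_derivI)
    qed
  qed
  have "((\<lambda>s. deriv g (F w + s * d) * d) has_field_derivative deriv (deriv g) (F w) * d * d) (at 0)"
  proof -
    have "((\<lambda>s. F w + s * d) has_field_derivative d) (at 0)"
      by (auto intro!: derivative_eq_intros)
    moreover have "(deriv g has_field_derivative deriv (deriv g) (F w)) (at (F w + 0 * d))"
      using g(1) by (simp add: analytic_derivI analytic_deriv)
    ultimately show ?thesis
      by (intro DERIV_cmult_right DERIV_chain2[where g = "\<lambda>s. F w + s * d"])
  qed
  then have "deriv (deriv k) 0 = deriv (deriv g) (F w) * d * d"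
    by (simp add: DERIV_imp_deriv deriv_cong_ev[OF kderiv refl])
  ultimately show "deriv k 0 = d / deriv F w"
      "deriv (deriv k) 0 = - pre_schwarzian F w * (d / deriv F w)\<^sup>2"
    using eventually_nhds_x_imp_x[OF kderiv] by (simp_all add: power2_eq_square)
qed

lemma deriv2_compose_at_critical_point:
  fixes \<phi> Y :: "complex \<Rightarrow> complex"
  assumes \<phi>: "\<phi> analytic_on {Y a}" and Y: "Y analytic_on {a}" "deriv Y a = 0"
  shows "deriv (deriv (\<lambda>s. \<phi> (Y s))) a = deriv \<phi> (Y a) * deriv (deriv Y) a"
proof -
  have Y1: "(Y has_field_derivative deriv Y a) (at a)"
    by (simp add: analytic_derivI Y(1))
  have "filterlim Y (nhds (Y a)) (nhds a)"
    using DERIV_isCont[OF Y1] isCont_def tendsto_at_iff_tendsto_nhds by blast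
  with eventually_analytic_at[OF \<phi>] have "eventually (\<lambda>s. \<phi> analytic_on {Y s}) (nhds a)"
    by (rule eventually_compose_filterlim)
  moreover have "eventually (\<lambda>s. Y analytic_on {s}) (nhds a)"
    by (rule eventually_analytic_at[OF Y(1)])
  ultimately have ev: "eventually (\<lambda>s. deriv (\<lambda>s. \<phi> (Y s)) s = deriv \<phi> (Y s) * deriv Y s) (nhds a)"
  proof eventually_elim
    case (elim s)
    show ?case
      by (rule DERIV_imp_deriv, rule DERIV_chain2[where g = Y])
        (use elim in \<open>auto intro: analytic_derivI\<close>)
  qed
  have \<phi>2: "(deriv \<phi> has_field_derivative deriv (deriv \<phi>) (Y a)) (at (Y a))"
    using \<phi> by (simp add: analytic_derivI analytic_deriv)
  have Y2: "(deriv Y has_field_derivative deriv (deriv Y) a) (at a)"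
    using Y(1) by (simp add: analytic_derivI analytic_deriv)
  have "((\<lambda>s. deriv \<phi> (Y s) * deriv Y s) has_field_derivative
      deriv \<phi> (Y a) * deriv (deriv Y) a + deriv (deriv \<phi>) (Y a) * deriv Y a * deriv Y a) (at a)"
    by (intro DERIV_mult' DERIV_chain2[where g = Y] \<phi>2 Y1 Y2)
  then show ?thesis
    using Y(2) by (simp add: DERIV_imp_deriv deriv_cong_ev[OF ev refl])
qed

section \<open>Maps of the right half plane whose pre-Schwarzian has nonnegative real part\<close>

abbreviation right_half_plane :: "complex set"
  where "right_half_plane \<equiv> {w. 0 < Re w}"

lemma open_right_half_plane: "open right_half_plane"
  by (simp add: open_halfspace_Re_gt)

lemma convex_right_half_plane: "convex right_half_plane"
  by (simp add: convex_halfspace_Re_gt)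

text \<open>The open mapping theorem replaces the minimum principle for the harmonic function \<open>Re q\<close>.\<close>

lemma constant_if_Re_vanishes:
  assumes q: "q holomorphic_on S" "open S" "connected S"
    and nonneg: "\<And>w. w \<in> S \<Longrightarrow> 0 \<le> Re (q w)"
    and w: "w \<in> S" "Re (q w) = 0"
  shows "q constant_on S"
proof (rule ccontr)
  assume "\<not> q constant_on S"
  then have "open (q ` S)"
    using open_mapping_thm[OF q q(2) order_refl] by blast
  then obtain e where e: "e > 0" "ball (q w) e \<subseteq> q ` S"
    using w(1) openE by blast
  have "q w - of_real (e / 2) \<in> ball (q w) e"
    using e(1) by (simp add: dist_norm)
  then obtain v where "v \<in> S" "q v = q w - of_real (e / 2)"
    using e(2) by (metis imageE subsetD)
  then show False
    using nonneg[of v] w(2) e(1) by simp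
qed

lemma constant_if_zero_derivative:
  fixes E :: "complex \<Rightarrow> complex"
  assumes "convex S" "\<And>w. w \<in> S \<Longrightarrow> (E has_field_derivative 0) (at w)"
  obtains C where "\<And>w. w \<in> S \<Longrightarrow> E w = C"
  using has_field_derivative_zero_constant[OF assms(1), of E] assms(2)[THEN has_field_derivative_at_within]
  by blast

lemma exp_derivative_if_pre_schwarzian_const:
  assumes F: "F holomorphic_on S" "open S" "convex S" "S \<noteq> {}"
    and nz: "\<And>w. w \<in> S \<Longrightarrow> deriv F w \<noteq> 0"
    and q: "\<And>w. w \<in> S \<Longrightarrow> pre_schwarzian F w = c"
  obtains C where "C \<noteq> 0" "\<And>w. w \<in> S \<Longrightarrow> deriv F w = C * exp (c * w)"
proof -
  obtain w0 where w0: "w0 \<in> S"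
    using F(4) by blast
  define E where "E w = deriv F w * exp (- c * w)" for w
  have "(E has_field_derivative 0) (at w)" if "w \<in> S" for w
  proof -
    have "(deriv F has_field_derivative deriv (deriv F) w) (at w)"
      by (rule holomorphic_derivI[OF holomorphic_deriv[OF F(1,2)] F(2) that])
    moreover have "deriv (deriv F) w = c * deriv F w"
      using q[OF that] nz[OF that] by (simp add: pre_schwarzian_def field_simps)
    ultimately show ?thesis
      unfolding E_def[abs_def] by (auto intro!: derivative_eq_intros simp: algebra_simps)
  qed
  then obtain C where C: "\<And>w. w \<in> S \<Longrightarrow> E w = C"
    using constant_if_zero_derivative[OF F(3)] by blast
  have "deriv F w = C * exp (c * w)" if "w \<in> S" for w
    using C[OF that] by (simp add: E_def exp_minus field_simps)
  moreover from this[OF w0] have "C \<noteq> 0"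
    using nz[OF w0] by auto
  ultimately show thesis
    using that by blast
qed

text \<open>The condition on the pre-Schwarzian says that \<open>F\<close> maps vertical lines to curves that bend around the
  complement of the image. Convexity follows by a maximum argument on a segment \<open>[a, b]\<close> with omitted
  endpoints: at a point of the segment whose preimage has the largest real part, the segment is
  tangent to the image of a vertical line and lies on the wrong side of it.\<close>

lemma convex_complement_half_plane_image:
  assumes F: "F holomorphic_on right_half_plane" and inj: "inj_on F right_half_plane"
    and infinity: "filterlim F at_infinity (inf at_infinity (principal right_half_plane))"
    and nonneg: "\<And>w. w \<in> right_half_plane \<Longrightarrow> 0 \<le> Re (pre_schwarzian F w)"
  shows "convex (- (F ` right_half_plane))"
proof (rule ccontr)
  let ?H = right_half_plane
  note open_H = open_right_half_plane
  have dF: "deriv F w \<noteq> 0" if "w \<in> ?H" for w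
    using holomorphic_injective_imp_regular[OF F open_H inj that] .
  assume "\<not> ?thesis"
  then obtain a b w0 where ab: "a \<notin> F ` ?H" "b \<notin> F ` ?H" and w0: "0 < Re w0" "F w0 \<in> closed_segment a b"
    unfolding convex_contains_segment by (auto simp: subset_iff)
  \<comment> \<open>The level Re w0 keeps W away from the boundary of the half plane, and F w tends to infinity with w,
    so W is compact although F need not extend to the boundary.\<close>
  define W where "W = {w. Re w0 \<le> Re w} \<inter> F -` closed_segment a b"
  have W_sub: "W \<subseteq> ?H"
    using w0(1) by (auto simp: W_def)
  have "bounded W"
  proof -
    obtain M where M: "\<And>z. z \<in> closed_segment a b \<Longrightarrow> cmod z \<le> M"
      using bounded_closed_segment[of a b] unfolding bounded_iff by blast
    have "eventually (\<lambda>w. M < cmod (F w)) (inf at_infinity (principal ?H))"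
      using infinity by (simp add: filterlim_at_infinity_conv_norm_at_top filterlim_at_top_dense)
    then obtain B where B: "\<And>w. B \<le> cmod w \<Longrightarrow> w \<in> ?H \<Longrightarrow> M < cmod (F w)"
      unfolding eventually_inf_principal eventually_at_infinity by blast
    have "cmod w \<le> B" if "w \<in> W" for w
      using B[of w] M[of "F w"] that W_sub by (force simp: W_def)
    then show ?thesis
      unfolding bounded_iff by blast
  qed
  moreover have "closed W"
  proof -
    have "continuous_on {w. Re w0 \<le> Re w} F"
      using w0(1) by (intro continuous_on_subset[OF holomorphic_on_imp_continuous_on[OF F]]) auto
    then show ?thesis
      unfolding W_def by (intro continuous_closed_preimage closed_halfspace_Re_ge) auto
  qed
  ultimately have "compact W"
    by (simp add: compact_eq_bounded_closed)
  moreover have "w0 \<in> W"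
    using w0 by (simp add: W_def)
  ultimately obtain w1 where w1: "w1 \<in> W" and w1_max: "\<And>w. w \<in> W \<Longrightarrow> Re w \<le> Re w1"
    using continuous_attains_sup[of W Re] continuous_on_Re[OF continuous_on_id] by (metis empty_iff id_apply)
  have w1_H: "w1 \<in> ?H" and w1_seg: "F w1 \<in> closed_segment a b"
    using w1 W_sub by (auto simp: W_def)
  obtain g where g: "g holomorphic_on F ` ?H" "\<And>w. w \<in> ?H \<Longrightarrow> g (F w) = w"
    using holomorphic_has_inverse[OF F open_H inj] by metis
  have open_FH: "open (F ` ?H)"
    by (rule open_mapping_thm3[OF F open_H inj])
  have ana_F: "F analytic_on {w1}" and ana_g: "g analytic_on {F w1}"
    using F open_H w1_H g(1) open_FH analytic_at by blast+
  have inv_g: "eventually (\<lambda>c. F (g c) = c) (nhds (F w1))"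
    using g(2) by (intro eventually_mono[OF eventually_nhds_in_open[OF open_FH]]) (use w1_H in auto)
  define d where "d = b - a"
  \<comment> \<open>The real part of the inverse of F, followed along the line through a and b, is maximal at s = 0.\<close>
  define k where "k s = g (F w1 + s * d)" for s
  have line_lim: "filterlim (\<lambda>s. F w1 + of_real s * d) (nhds (F w1)) (nhds (0::real))"
    by (auto intro!: tendsto_eq_intros filterlim_ident)
  obtain t where t: "F w1 = a + of_real t * d" "0 \<le> t" "t \<le> 1"
    using w1_seg by (auto simp: closed_segment_def d_def algebra_simps scaleR_conv_of_real)
  have "t \<noteq> 0" "t \<noteq> 1"
    using t(1) ab w1_H by (force simp: d_def)+
  with t have t01: "0 < t" "t < 1"
    by auto
  have "d \<noteq> 0"
    using t(1) ab(1) w1_H by force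
  have "eventually (\<lambda>s::real. F w1 + of_real s * d \<in> F ` ?H) (nhds 0)"
    by (rule eventually_compose_filterlim[OF eventually_nhds_in_open[OF open_FH] line_lim]) (use w1_H in auto)
  moreover have "eventually (\<lambda>s. s \<in> {- t <..< 1 - t}) (nhds 0)"
    using t01 by (intro eventually_nhds_in_open) auto
  ultimately have "eventually (\<lambda>s::real. Re (k (of_real s)) \<le> Re (k 0)) (nhds 0)"
  proof eventually_elim
    case (elim s)
    then obtain w where w: "w \<in> ?H" "F w1 + of_real s * d = F w"
      by blast
    have "F w \<in> closed_segment a b"
      unfolding w(2)[symmetric] t(1) closed_segment_def using elim(2)
      by (auto simp: d_def algebra_simps scaleR_conv_of_real intro!: exI[of _ "t + s"])
    \<comment> \<open>Points below the level Re w0 do not belong to W, but they lie to the left of w1 anyway.\<close>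
    then have "Re w \<le> Re w1"
      using w1_max[of w] w(1) w1_max[OF \<open>w0 \<in> W\<close>] by (cases "Re w0 \<le> Re w") (auto simp: W_def)
    then show ?case
      using g(2) w w1_H by (simp add: k_def)
  qed
  moreover have "k analytic_on {0}"
  proof -
    have "g \<circ> (\<lambda>s. F w1 + s * d) analytic_on {0}"
      using ana_g by (intro analytic_on_compose) (auto intro!: analytic_intros)
    then show ?thesis
      by (simp add: o_def k_def[abs_def])
  qed
  ultimately have k: "Re (deriv k 0) = 0" "Re (deriv (deriv k) 0) \<le> 0"
    using Re_local_max_second_order by blast+
  define \<tau> where "\<tau> = Im (d / deriv F w1)"
  have dk: "deriv k 0 = d / deriv F w1" "deriv (deriv k) 0 = - pre_schwarzian F w1 * (d / deriv F w1)\<^sup>2"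
    using deriv2_inverse_along_line[OF ana_F dF[OF w1_H] ana_g inv_g g(2)[OF w1_H], of d]
    by (simp_all add: k_def[abs_def])
  then have \<tau>: "d / deriv F w1 = \<i> * of_real \<tau>"
    using k(1) by (simp add: \<tau>_def complex_eq_iff)
  then have "\<tau> \<noteq> 0"
    using \<open>d \<noteq> 0\<close> dF[OF w1_H] by auto
  moreover have "Re (deriv (deriv k) 0) = Re (pre_schwarzian F w1) * \<tau>\<^sup>2"
    unfolding dk \<tau> by (simp add: power_mult_distrib flip: of_real_power)
  ultimately have "Re (pre_schwarzian F w1) \<le> 0"
    using k(2) by (simp add: mult_le_0_iff)
  then have "Re (pre_schwarzian F w1) = 0"
    using nonneg[OF w1_H] by simp
  moreover have "pre_schwarzian F holomorphic_on ?H"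
    using F open_H dF by (rule holomorphic_on_pre_schwarzian)
  \<comment> \<open>The second-order condition at the maximum makes a nonnegative harmonic function vanish somewhere.\<close>
  ultimately have "pre_schwarzian F constant_on ?H"
    using nonneg w1_H open_H convex_connected[OF convex_right_half_plane] by (intro constant_if_Re_vanishes)
  then have const: "pre_schwarzian F w = pre_schwarzian F w1" if "w \<in> ?H" for w
    using that w1_H unfolding constant_on_def by metis
  define \<beta> where "\<beta> = Im (pre_schwarzian F w1)"
  have \<beta>: "pre_schwarzian F w1 = \<i> * of_real \<beta>"
    using \<open>Re (pre_schwarzian F w1) = 0\<close> by (simp add: \<beta>_def complex_eq_iff)
  obtain C where C: "C \<noteq> 0" "\<And>w. w \<in> ?H \<Longrightarrow> deriv F w = C * exp (\<i> * of_real \<beta> * w)"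
    using exp_derivative_if_pre_schwarzian_const[OF F open_H convex_right_half_plane _ dF const[unfolded \<beta>]] w1_H by blast
  have dF': "(F has_field_derivative C * exp (\<i> * of_real \<beta> * w)) (at w)" if "w \<in> ?H" for w
    using holomorphic_derivI[OF F open_H that] C(2)[OF that] by simp
  show False
  proof (cases "\<beta> = 0")
    case True
    have "((\<lambda>w. F w - C * w) has_field_derivative 0) (at w)" if "w \<in> ?H" for w
      using dF'[OF that] True by (auto intro!: derivative_eq_intros)
    then obtain D where "\<And>w. w \<in> ?H \<Longrightarrow> F w - C * w = D"
      using constant_if_zero_derivative[OF convex_right_half_plane] by blast
    then have D: "F w = C * w + D" if "w \<in> ?H" for w
      using that by (simp add: algebra_simps)
    have omit: "Re ((c - D) / C) \<le> 0" if "c \<notin> F ` ?H" for c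
    proof (rule ccontr)
      assume "\<not> ?thesis"
      then have "F ((c - D) / C) = c" "(c - D) / C \<in> ?H"
        using D[of "(c - D) / C"] C(1) by auto
      with that show False
        by (metis imageI)
    qed
    define a' b' where "a' = (a - D) / C" and "b' = (b - D) / C"
    have "w1 = of_real (1 - t) * a' + of_real t * b'"
      using D[OF w1_H] C(1) t(1) by (simp add: d_def a'_def b'_def field_simps)
    then have "Re w1 = (1 - t) * Re a' + t * Re b'"
      by simp
    also have "\<dots> \<le> 0"
      using omit[OF ab(1)] omit[OF ab(2)] t01 unfolding a'_def b'_def by (intro add_nonpos_nonpos mult_nonneg_nonpos) auto
    finally show False
      using w1_H by simp
  next
    case False
    define E where "E w = F w - C / (\<i> * of_real \<beta>) * exp (\<i> * of_real \<beta> * w)" for w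
    have "(E has_field_derivative 0) (at w)" if "w \<in> ?H" for w
      unfolding E_def[abs_def] using dF'[OF that] False by (auto intro!: derivative_eq_intros)
    then obtain D where D: "\<And>w. w \<in> ?H \<Longrightarrow> E w = D"
      using constant_if_zero_derivative[OF convex_right_half_plane] by blast
    \<comment> \<open>The derivative of F is a periodic exponential, with a period along the real direction.\<close>
    define w2 where "w2 = w1 + of_real (2 * pi / \<bar>\<beta>\<bar>)"
    have w2_H: "w2 \<in> ?H" and "w2 \<noteq> w1"
      using w1_H False by (auto simp: w2_def intro!: add_pos_pos)
    have "exp (\<i> * of_real \<beta> * w2) = exp (\<i> * of_real \<beta> * w1 + 2 * of_real (sgn \<beta>) * pi * \<i>)"
      using False by (simp add: w2_def algebra_simps sgn_if)
    also have "\<dots> = exp (\<i> * of_real \<beta> * w1)"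
      unfolding exp_eq by (intro exI[of _ "if \<beta> > 0 then 1 else -1"]) (use False in \<open>auto simp: sgn_if algebra_simps\<close>)
    finally have exp_eq: "exp (\<i> * of_real \<beta> * w2) = exp (\<i> * of_real \<beta> * w1)" .
    have "E w2 = E w1"
      using D[OF w1_H] D[OF w2_H] by simp
    then have "F w2 = F w1"
      unfolding E_def exp_eq by simp
    with inj w1_H w2_H \<open>w2 \<noteq> w1\<close> show False
      by (meson inj_onD)
  qed
qed

lemma half_plane_derivative_mono:
  assumes F: "F holomorphic_on right_half_plane" and dF: "\<And>w. w \<in> right_half_plane \<Longrightarrow> deriv F w \<noteq> 0"
    and nonneg: "\<And>w. w \<in> right_half_plane \<Longrightarrow> 0 \<le> Re (pre_schwarzian F w)"
    and x: "0 < x" "x \<le> x'"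
  shows "cmod (deriv F (Complex x y)) \<le> cmod (deriv F (Complex x' y))"
proof -
  \<comment> \<open>The square of the modulus is differentiable and avoids a logarithm of F'.\<close>
  define m where "m s = (cmod (deriv F (Complex s y)))\<^sup>2" for s
  have m: "(m has_real_derivative 2 * m s * Re (pre_schwarzian F (Complex s y))) (at s)" if "0 < s" for s
  proof -
    have H: "Complex s y \<in> right_half_plane"
      using that by simp
    have "(deriv F has_field_derivative deriv (deriv F) (Complex s y)) (at (Complex s y))"
      by (rule holomorphic_derivI[OF holomorphic_deriv[OF F open_right_half_plane] open_right_half_plane H])
    moreover have "((\<lambda>s. Complex s y) has_vector_derivative 1) (at s)"
      by (auto simp: Complex_eq intro!: derivative_eq_intros)
    ultimately have "((deriv F \<circ> (\<lambda>s. Complex s y)) has_vector_derivative 1 * deriv (deriv F) (Complex s y)) (at s)"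
      by (intro field_vector_diff_chain_at) 
    then have v: "((\<lambda>s. deriv F (Complex s y)) has_vector_derivative deriv (deriv F) (Complex s y)) (at s)"
      by (simp add: o_def)
    have "(m has_real_derivative 2 * Re (deriv F (Complex s y)) * Re (deriv (deriv F) (Complex s y))
        + 2 * Im (deriv F (Complex s y)) * Im (deriv (deriv F) (Complex s y))) (at s)"
      unfolding m_def[abs_def] cmod_power2 by (auto intro!: derivative_eq_intros v)
    moreover have "deriv (deriv F) (Complex s y) = pre_schwarzian F (Complex s y) * deriv F (Complex s y)"
      using dF[OF H] by (simp add: pre_schwarzian_def)
    moreover have "m s = (Re (deriv F (Complex s y)))\<^sup>2 + (Im (deriv F (Complex s y)))\<^sup>2"
      by (simp add: m_def cmod_power2)
    ultimately show ?thesis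
      by (simp add: algebra_simps power2_eq_square)
  qed
  have "m x \<le> m x'"
  proof (rule DERIV_nonneg_imp_nondecreasing[OF x(2)])
    fix s assume "x \<le> s" "s \<le> x'"
    then show "\<exists>l. (m has_real_derivative l) (at s) \<and> 0 \<le> l"
      using m[of s] nonneg[of "Complex s y"] x(1)
      by (intro exI[of _ "2 * m s * Re (pre_schwarzian F (Complex s y))"]) (auto simp: m_def)
  qed
  then show ?thesis
    by (simp add: m_def)
qed

lemma half_plane_bounded_at_boundary:
  assumes F: "F holomorphic_on right_half_plane" and dF: "\<And>w. w \<in> right_half_plane \<Longrightarrow> deriv F w \<noteq> 0"
    and nonneg: "\<And>w. w \<in> right_half_plane \<Longrightarrow> 0 \<le> Re (pre_schwarzian F w)"
    and x: "0 < x" "x \<le> 1"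
  shows "cmod (F (Complex x y) - F (Complex 1 y)) \<le> cmod (deriv F (Complex 1 y))"
proof -
  let ?S = "closed_segment (Complex 1 y) (Complex x y)"
  have S: "\<exists>s. 0 < s \<and> s \<le> 1 \<and> w = Complex s y" if "w \<in> ?S" for w
  proof -
    obtain u where u: "0 \<le> u" "u \<le> 1" "w = (1 - u) *\<^sub>R Complex 1 y + u *\<^sub>R Complex x y"
      using \<open>w \<in> ?S\<close> by (auto simp: closed_segment_def)
    have "0 < (1 - u) * x + u * x"
      using x(1) by (simp add: algebra_simps)
    also have "\<dots> \<le> (1 - u) * 1 + u * x"
      using x u by (intro add_mono mult_left_mono) auto
    finally have "0 < 1 - u + u * x"
      by simp
    moreover have "u * x \<le> u * 1"
      using x u by (intro mult_left_mono) auto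
    moreover have "w = Complex (1 - u + u * x) y"
      using u(3) by (simp add: complex_eq_iff algebra_simps)
    ultimately show ?thesis
      by (intro exI[of _ "1 - u + u * x"]) simp
  qed
  have "cmod (F (Complex x y) - F (Complex 1 y)) \<le> cmod (deriv F (Complex 1 y)) * cmod (Complex x y - Complex 1 y)"
  proof (rule field_differentiable_bound)
    fix w assume "w \<in> ?S"
    then obtain s where s: "0 < s" "s \<le> 1" "w = Complex s y"
      using S by blast
    then show "(F has_field_derivative deriv F w) (at w within ?S)"
      by (intro holomorphic_derivI[OF F open_right_half_plane, THEN has_field_derivative_at_within]) auto
    show "cmod (deriv F w) \<le> cmod (deriv F (Complex 1 y))"
      unfolding s(3) by (rule half_plane_derivative_mono[OF F dF nonneg s(1,2)])
  qed auto
  also have "\<dots> \<le> cmod (deriv F (Complex 1 y)) * 1"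
    using x by (intro mult_left_mono) (auto simp: cmod_def)
  finally show ?thesis
    by simp
qed

section \<open>Sufficiency: transplantation to the half plane\<close>

text \<open>This is \<open>\<zeta> (w - 1) / (w + 1)\<close>, written with explicit coefficients in order to match the general
  Moebius map.\<close>

definition cayley :: "complex \<Rightarrow> complex \<Rightarrow> complex"
  where "cayley \<zeta> w = (\<zeta> * w + - \<zeta>) / (1 * w + 1)"

lemma right_half_plane_plus_1_nz: "w \<in> right_half_plane \<Longrightarrow> 1 * w + 1 \<noteq> 0"
  by (auto simp: complex_eq_iff)

lemma cayley_in_unit_disk:
  assumes "cmod \<zeta> = 1" "w \<in> right_half_plane"
  shows "cayley \<zeta> w \<in> unit_disk"
proof -
  have "cmod (w - 1) < cmod (w + 1)"
    using assms(2) by (auto simp: cmod_def power2_eq_square algebra_simps)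
  moreover have "\<zeta> * w + - \<zeta> = \<zeta> * (w - 1)"
    by (simp add: algebra_simps)
  moreover have "0 < cmod (w + 1)"
    using calculation(1) norm_ge_zero order_le_less_trans by blast
  ultimately show ?thesis
    using assms(1) by (simp add: cayley_def norm_divide norm_mult)
qed

lemma cayley_onto:
  assumes "cmod \<zeta> = 1" "z \<in> unit_disk"
  obtains w where "w \<in> right_half_plane" "cayley \<zeta> w = z"
proof
  have nz: "\<zeta> - z \<noteq> 0" "\<zeta> \<noteq> 0"
    using assms by auto
  have "Re ((\<zeta> + z) * cnj (\<zeta> - z)) = (cmod \<zeta>)\<^sup>2 - (cmod z)\<^sup>2"
    unfolding cmod_power2 by (simp add: algebra_simps power2_eq_square)
  then have "0 < Re ((\<zeta> + z) * cnj (\<zeta> - z))"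
    using assms one_minus_cmod_square_pos[OF assms(2)] by simp
  then show "(\<zeta> + z) / (\<zeta> - z) \<in> right_half_plane"
    using nz by (simp add: Re_divide_Reals complex_div_cnj[of "\<zeta> + z"] Re_divide_of_real flip: of_real_power)
  have eqs: "(\<zeta> + z) / (\<zeta> - z) + 1 = 2 * \<zeta> / (\<zeta> - z)" "(\<zeta> + z) / (\<zeta> - z) - 1 = 2 * z / (\<zeta> - z)"
    using nz by (simp_all add: field_simps)
  have cayley_eq: "cayley \<zeta> w = \<zeta> * (w - 1) / (w + 1)" for w
    by (simp add: cayley_def algebra_simps)
  show "cayley \<zeta> ((\<zeta> + z) / (\<zeta> - z)) = z"
    unfolding cayley_eq eqs using nz by simp
qed

lemma cayley_inj:
  assumes "\<zeta> \<noteq> 0" shows "inj_on (cayley \<zeta>) right_half_plane"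
proof (rule inj_onI)
  fix v w assume vw: "v \<in> right_half_plane" "w \<in> right_half_plane" "cayley \<zeta> v = cayley \<zeta> w"
  have "(\<zeta> * v - \<zeta>) * (w + 1) = (\<zeta> * w - \<zeta>) * (v + 1)"
    using vw right_half_plane_plus_1_nz[OF vw(1)] right_half_plane_plus_1_nz[OF vw(2)]
    by (simp add: cayley_def frac_eq_eq)
  then have "2 * \<zeta> * (v - w) = 0"
    by (simp add: algebra_simps)
  with assms show "v = w"
    by simp
qed

lemma holomorphic_on_compose_cayley:
  assumes "f holomorphic_on unit_disk" "cmod \<zeta> = 1"
  shows "(\<lambda>w. f (cayley \<zeta> w)) holomorphic_on right_half_plane"
proof -
  have "cayley \<zeta> holomorphic_on right_half_plane"
    unfolding cayley_def[abs_def] using right_half_plane_plus_1_nz by (auto intro!: holomorphic_intros)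
  moreover have "cayley \<zeta> ` right_half_plane \<subseteq> unit_disk"
    using cayley_in_unit_disk[OF assms(2)] by blast
  ultimately show ?thesis
    using holomorphic_on_compose_gen[of "cayley \<zeta>" right_half_plane f unit_disk] assms(1)
    by (simp add: o_def)
qed

text \<open>With \<open>s\<close> the osculating pole at \<open>z\<close>, the pre-Schwarzian of the transplanted map is
  \<open>cnj \<zeta> (\<zeta> - z) (\<zeta> - s) / (s - z)\<close>. The sign of its real part is the sign of
  \<open>(1 - \<bar>s\<bar>\<^sup>2) \<bar>\<zeta> - z\<bar>\<^sup>2 - (1 - \<bar>z\<bar>\<^sup>2) \<bar>\<zeta> - s\<bar>\<^sup>2\<close>, which is what invariance of the horodisks at \<open>\<zeta>\<close>
  controls.\<close>

lemma Re_pre_schwarzian_cayley_nonneg: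
  assumes f: "f holomorphic_on unit_disk" and df: "\<And>z. z \<in> unit_disk \<Longrightarrow> deriv f z \<noteq> 0"
    and p: "\<And>z. z \<in> unit_disk \<Longrightarrow> pre_schwarzian f z \<noteq> 0"
    and \<zeta>: "cmod \<zeta> = 1"
    and horo: "\<And>z. z \<in> unit_disk \<Longrightarrow> (1 - (cmod z)\<^sup>2) * (cmod (\<zeta> - osculating_pole f z))\<^sup>2
                 \<le> (1 - (cmod (osculating_pole f z))\<^sup>2) * (cmod (\<zeta> - z))\<^sup>2"
    and w: "w \<in> right_half_plane"
  shows "0 \<le> Re (pre_schwarzian (\<lambda>w. f (cayley \<zeta> w)) w)"
proof -
  define z where "z = cayley \<zeta> w"
  define s where "s = osculating_pole f z"
  have z: "z \<in> unit_disk"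
    unfolding z_def by (rule cayley_in_unit_disk[OF \<zeta> w])
  have \<zeta>0: "\<zeta> \<noteq> 0" and \<zeta>1: "cnj \<zeta> * \<zeta> = 1" and \<zeta>z: "\<zeta> - z \<noteq> 0"
    using \<zeta> z by (auto simp: complex_norm_square[symmetric] mult.commute[of "cnj \<zeta>"])
  note nz = right_half_plane_plus_1_nz[OF w]
  have w1: "w + 1 = 2 * \<zeta> / (\<zeta> - z)"
  proof -
    have "(w + 1) * (\<zeta> - z) = 2 * \<zeta>"
      using nz by (simp add: z_def cayley_def field_simps)
    with \<zeta>z show ?thesis
      by (simp add: field_simps)
  qed
  have s: "s - z \<noteq> 0" "pre_schwarzian f z = 2 / (s - z)"
    using p[OF z] by (simp_all add: s_def osculating_pole_def)
  have dc: "deriv (cayley \<zeta>) w = 2 * \<zeta> / (w + 1)\<^sup>2"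
    unfolding cayley_def[abs_def]
    using moebius_map_has_field_derivative[OF nz, of \<zeta> "- \<zeta>"] by (simp add: DERIV_imp_deriv)
  have pc: "pre_schwarzian (cayley \<zeta>) w = - 2 / (w + 1)"
    unfolding cayley_def[abs_def] using pre_schwarzian_moebius_map[OF nz, of \<zeta> "- \<zeta>"] \<zeta>0 by simp
  have "pre_schwarzian (\<lambda>w. f (cayley \<zeta> w)) w = pre_schwarzian f z * (2 * \<zeta> / (w + 1)\<^sup>2) + - 2 / (w + 1)"
    unfolding z_def dc[symmetric] pc[symmetric]
  proof (rule pre_schwarzian_compose)
    show "f analytic_on {cayley \<zeta> w}"
      using f z unfolding z_def by (meson analytic_at open_ball)
    show "cayley \<zeta> analytic_on {w}"
      unfolding cayley_def[abs_def] by (rule moebius_map_analytic[OF nz])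
    show "deriv f (cayley \<zeta> w) \<noteq> 0"
      using df z unfolding z_def by blast
    show "deriv (cayley \<zeta>) w \<noteq> 0"
      unfolding dc using nz \<zeta>0 by simp
  qed
  also have "\<dots> = cnj \<zeta> * (\<zeta> - z) * (\<zeta> - s) / (s - z)"
  proof -
    have cnj_eq: "cnj \<zeta> = 1 / \<zeta>"
      using \<zeta>1 \<zeta>0 by (simp add: field_simps)
    show ?thesis
      unfolding cnj_eq w1 s(2) using \<zeta>0 \<zeta>z s(1) by (simp add: field_simps power2_eq_square)
  qed
  finally have q: "pre_schwarzian (\<lambda>w. f (cayley \<zeta> w)) w = cnj \<zeta> * (\<zeta> - z) * (\<zeta> - s) / (s - z)" .
  have "2 * Re (cnj \<zeta> * (\<zeta> - z) * (\<zeta> - s) * cnj (s - z))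
      = (1 - (cmod s)\<^sup>2) * (cmod (\<zeta> - z))\<^sup>2 - (1 - (cmod z)\<^sup>2) * (cmod (\<zeta> - s))\<^sup>2"
  proof -
    have half: "2 * Re (1 - cnj \<zeta> * v) = (cmod (\<zeta> - v))\<^sup>2 + 1 - (cmod v)\<^sup>2" for v
    proof -
      have "(cmod (\<zeta> - v))\<^sup>2 = (cmod \<zeta>)\<^sup>2 + (cmod v)\<^sup>2 - 2 * Re (cnj \<zeta> * v)"
        unfolding cmod_power2 by (simp add: algebra_simps power2_eq_square)
      with \<zeta> show ?thesis
        by simp
    qed
    have "cnj \<zeta> * (\<zeta> - z) * (\<zeta> - s) * cnj (s - z)
        = of_real ((cmod (\<zeta> - z))\<^sup>2) * (cnj \<zeta> * (\<zeta> - s)) - of_real ((cmod (\<zeta> - s))\<^sup>2) * (cnj \<zeta> * (\<zeta> - z))"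
      unfolding complex_norm_square by (simp add: algebra_simps)
    also have "\<dots> = of_real ((cmod (\<zeta> - z))\<^sup>2) * (1 - cnj \<zeta> * s) - of_real ((cmod (\<zeta> - s))\<^sup>2) * (1 - cnj \<zeta> * z)"
      using \<zeta>1 by (simp add: right_diff_distrib)
    finally have expand: "cnj \<zeta> * (\<zeta> - z) * (\<zeta> - s) * cnj (s - z) = \<dots>" .
    have "2 * Re (of_real x * u - of_real y * v) = x * (2 * Re u) - y * (2 * Re v)" for x y u v
      by simp
    then have "2 * Re (cnj \<zeta> * (\<zeta> - z) * (\<zeta> - s) * cnj (s - z))
        = (cmod (\<zeta> - z))\<^sup>2 * (2 * Re (1 - cnj \<zeta> * s)) - (cmod (\<zeta> - s))\<^sup>2 * (2 * Re (1 - cnj \<zeta> * z))"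
      unfolding expand .
    then show ?thesis
      unfolding half by (simp add: algebra_simps)
  qed
  also have "\<dots> \<ge> 0"
    using horo[OF z] by (simp add: s_def)
  finally have "0 \<le> Re (cnj \<zeta> * (\<zeta> - z) * (\<zeta> - s) * cnj (s - z))"
    by simp
  moreover have "pre_schwarzian (\<lambda>w. f (cayley \<zeta> w)) w
      = cnj \<zeta> * (\<zeta> - z) * (\<zeta> - s) * cnj (s - z) / of_real ((cmod (s - z))\<^sup>2)"
    unfolding q by (subst complex_div_cnj) simp
  ultimately show ?thesis
    by (simp add: Re_divide_of_real del: of_real_power)
qed

text \<open>Otherwise the boundary point \<open>1\<close> of the disk would correspond to a finite boundary point of the half
  plane, and the transplanted map would be bounded along a ray that ends there.\<close>

lemma boundary_point_eq_1:
  assumes f: "f holomorphic_on unit_disk" "infinite_at_one f" and \<zeta>: "cmod \<zeta> = 1"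
    and dF: "\<And>w. w \<in> right_half_plane \<Longrightarrow> deriv (\<lambda>w. f (cayley \<zeta> w)) w \<noteq> 0"
    and nonneg: "\<And>w. w \<in> right_half_plane \<Longrightarrow> 0 \<le> Re (pre_schwarzian (\<lambda>w. f (cayley \<zeta> w)) w)"
  shows "\<zeta> = 1"
proof (rule ccontr)
  assume ne: "\<zeta> \<noteq> 1"
  \<comment> \<open>The boundary point i y of the half plane corresponds to the boundary point 1 of the disk.\<close>
  define y where "y = Im ((\<zeta> + 1) / (\<zeta> - 1))"
  have "Re ((\<zeta> + 1) * cnj (\<zeta> - 1)) = (cmod \<zeta>)\<^sup>2 - 1"
    unfolding cmod_power2 by (simp add: algebra_simps power2_eq_square)
  then have "Re ((\<zeta> + 1) / (\<zeta> - 1)) = 0"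
    using \<zeta> by (simp add: complex_div_cnj[of "\<zeta> + 1"] Re_divide_of_real flip: of_real_power)
  then have iy: "Complex 0 y = (\<zeta> + 1) / (\<zeta> - 1)"
    by (simp add: y_def complex_eq_iff)
  have iy1: "Complex 0 y + 1 = 2 * \<zeta> / (\<zeta> - 1)" "Complex 0 y - 1 = 2 / (\<zeta> - 1)"
    unfolding iy using ne by (simp_all add: field_simps)
  have "\<zeta> \<noteq> 0"
    using \<zeta> by auto
  with iy1(1) ne have nz: "1 * Complex 0 y + 1 \<noteq> 0"
    by simp
  have "\<zeta> * Complex 0 y + - \<zeta> = \<zeta> * (Complex 0 y - 1)"
    by (simp add: algebra_simps)
  then have at_0: "cayley \<zeta> (Complex 0 y) = 1"
    using iy1 ne \<open>\<zeta> \<noteq> 0\<close> by (simp add: cayley_def)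
  have "((\<lambda>x. cayley \<zeta> (Complex x y)) \<longlongrightarrow> cayley \<zeta> (Complex 0 y)) (at_right 0)"
    unfolding cayley_def by (intro tendsto_intros nz)
  moreover have "eventually (\<lambda>x. cayley \<zeta> (Complex x y) \<in> unit_disk \<and> cayley \<zeta> (Complex x y) \<noteq> 1) (at_right 0)"
    unfolding eventually_at_right_field
  proof (intro exI[of _ 1] conjI allI impI)
    fix x :: real assume "0 < x"
    then show "cayley \<zeta> (Complex x y) \<in> unit_disk"
      by (intro cayley_in_unit_disk[OF \<zeta>]) simp
    then show "cayley \<zeta> (Complex x y) \<noteq> 1"
      by auto
  qed simp
  ultimately have "filterlim (\<lambda>x. cayley \<zeta> (Complex x y)) (at 1 within unit_disk) (at_right 0)"
    unfolding at_0 by (simp add: filterlim_at)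
  then have "filterlim (\<lambda>x. f (cayley \<zeta> (Complex x y))) at_infinity (at_right 0)"
    using f(2) unfolding infinite_at_one_def by (rule filterlim_compose[rotated])
  then have "filterlim (\<lambda>x. cmod (f (cayley \<zeta> (Complex x y)))) at_top (at_right 0)"
    by (simp add: filterlim_at_infinity_conv_norm_at_top)
  then have "eventually (\<lambda>x. cmod (f (cayley \<zeta> (Complex 1 y))) + cmod (deriv (\<lambda>w. f (cayley \<zeta> w)) (Complex 1 y))
      < cmod (f (cayley \<zeta> (Complex x y)))) (at_right 0)"
    by (simp add: filterlim_at_top_dense)
  moreover have "eventually (\<lambda>x. 0 < x \<and> x \<le> 1) (at_right (0::real))"
    unfolding eventually_at_right_field by (intro exI[of _ 1]) auto
  ultimately have "eventually (\<lambda>x. False) (at_right (0::real))"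
  proof eventually_elim
    case (elim x)
    then show ?case
      using half_plane_bounded_at_boundary[OF holomorphic_on_compose_cayley[OF f(1) \<zeta>] dF nonneg, of x y]
        norm_triangle_sub[of "f (cayley \<zeta> (Complex x y))" "f (cayley \<zeta> (Complex 1 y))"] by simp
  qed
  then show False
    by simp
qed

theorem convex_complement_if_A_op_ge_1:
  assumes f: "f holomorphic_on unit_disk" "inj_on f unit_disk" "infinite_at_one f"
    and A: "\<And>z. z \<in> unit_disk \<Longrightarrow> 1 \<le> cmod (A_op f z)"
  shows "convex (- (f ` unit_disk))"
proof -
  have df: "deriv f z \<noteq> 0" if "z \<in> unit_disk" for z
    using holomorphic_injective_imp_regular[OF f(1) open_ball f(2) that] .
  have p: "pre_schwarzian f z \<noteq> 0" if "z \<in> unit_disk" for z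
    using cmod_A_op_less_1[OF that, of f] A[OF that] by auto
  have holp: "pre_schwarzian f holomorphic_on unit_disk"
    using f(1) df by (intro holomorphic_on_pre_schwarzian) auto
  obtain \<zeta> where \<zeta>: "cmod \<zeta> = 1"
    and horo: "\<And>z. z \<in> unit_disk \<Longrightarrow> (1 - (cmod z)\<^sup>2) * (cmod (\<zeta> - osculating_pole f z))\<^sup>2
                 \<le> (1 - (cmod (osculating_pole f z))\<^sup>2) * (cmod (\<zeta> - z))\<^sup>2"
  proof (rule Wolff_boundary_point[of "osculating_pole f"])
    show "osculating_pole f holomorphic_on unit_disk"
      using holp p by (rule holomorphic_on_osculating_pole)
    show "osculating_pole f \<in> unit_disk \<rightarrow> cball 0 1"
      using cmod_A_op_ge_1_iff p A by auto
    show "osculating_pole f z \<noteq> z" if "z \<in> unit_disk" for z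
      using p[OF that] by (simp add: osculating_pole_def)
  qed blast
  define F where "F w = f (cayley \<zeta> w)" for w
  have F: "F holomorphic_on right_half_plane"
    unfolding F_def[abs_def] by (rule holomorphic_on_compose_cayley[OF f(1) \<zeta>])
  have inj: "inj_on F right_half_plane"
  proof -
    have "\<zeta> \<noteq> 0"
      using \<zeta> by auto
    then have "inj_on (f \<circ> cayley \<zeta>) right_half_plane"
      using cayley_inj[of \<zeta>] f(2) cayley_in_unit_disk[OF \<zeta>]
      by (intro comp_inj_on) (auto intro: inj_on_subset)
    then show ?thesis
      by (simp add: F_def[abs_def] o_def)
  qed
  have dF: "deriv F w \<noteq> 0" if "w \<in> right_half_plane" for w
    using holomorphic_injective_imp_regular[OF F open_right_half_plane inj that] .
  have nonneg: "0 \<le> Re (pre_schwarzian F w)" if "w \<in> right_half_plane" for w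
    unfolding F_def[abs_def] by (rule Re_pre_schwarzian_cayley_nonneg[OF f(1) df p \<zeta> horo that])
  have "\<zeta> = 1"
    using dF nonneg unfolding F_def[abs_def] by (rule boundary_point_eq_1[OF f(1,3) \<zeta>])
  have "filterlim F at_infinity (inf at_infinity (principal right_half_plane))"
  proof -
    let ?G = "inf at_infinity (principal right_half_plane)"
    have "filterlim (\<lambda>w::complex. w + 1) at_infinity at_infinity"
      by (rule tendsto_add_filterlim_at_infinity'[OF filterlim_ident tendsto_const])
    then have "((\<lambda>w::complex. 1 - 2 / (w + 1)) \<longlongrightarrow> 1 - 0) at_infinity"
      by (intro tendsto_diff tendsto_const tendsto_divide_0[OF tendsto_const])
    from tendsto_mono[OF inf_le1 this] have "((\<lambda>w. 1 - 2 / (w + 1)) \<longlongrightarrow> 1) ?G"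
      by simp
    moreover have ev: "eventually (\<lambda>w. w \<in> right_half_plane) ?G"
      by (simp add: eventually_inf_principal)
    moreover have "cayley \<zeta> w = 1 - 2 / (w + 1)" if "w \<in> right_half_plane" for w
      using right_half_plane_plus_1_nz[OF that] \<open>\<zeta> = 1\<close> by (simp add: cayley_def field_simps)
    ultimately have "(cayley \<zeta> \<longlongrightarrow> 1) ?G"
      using tendsto_cong[of "cayley \<zeta>" "\<lambda>w. 1 - 2 / (w + 1)" ?G] eventually_mono[OF ev] by simp
    moreover have "eventually (\<lambda>w. cayley \<zeta> w \<in> unit_disk \<and> cayley \<zeta> w \<noteq> 1) ?G"
      using ev by (rule eventually_mono) (use cayley_in_unit_disk[OF \<zeta>] in fastforce)
    ultimately have "filterlim (cayley \<zeta>) (at 1 within unit_disk) ?G"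
      by (simp add: filterlim_at)
    then show ?thesis
      unfolding F_def[abs_def] using f(3) infinite_at_one_def filterlim_compose by blast
  qed
  then have "convex (- (F ` right_half_plane))"
    using F inj nonneg by (intro convex_complement_half_plane_image)
  moreover have "F ` right_half_plane = f ` unit_disk"
  proof -
    have "cayley \<zeta> ` right_half_plane = unit_disk"
      using cayley_in_unit_disk[OF \<zeta>] cayley_onto[OF \<zeta>] by (metis (no_types) image_eqI image_subsetI subsetI subset_antisym)
    then show ?thesis
      unfolding F_def[abs_def] by (metis image_image)
  qed
  ultimately show ?thesis
    by simp
qed

section \<open>Complements of convex sets after inversion\<close>

text \<open>The exterior of \<open>K\<close> in the sphere, seen in the coordinate \<open>1 / a\<close>. The point \<open>0\<close> stands for infinity
  and has to be added by hand, since \<open>inverse 0 = 0\<close> and \<open>0 \<in> K\<close> in the application.\<close>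

definition inverted_complement :: "complex set \<Rightarrow> complex set"
  where "inverted_complement K = {r. r = 0 \<or> inverse r \<notin> K}"

lemma closed_inverse_preimage_compact:
  fixes C :: "complex set"
  assumes "compact C"
  shows "closed {a. a \<noteq> 0 \<and> inverse a \<in> C}"
  unfolding closed_sequential_limits
proof (intro allI impI, elim conjE)
  fix x l assume x: "\<forall>n. x n \<in> {a. a \<noteq> 0 \<and> inverse a \<in> C}" and lim: "x \<longlonglongrightarrow> l"
  obtain B where B: "B > 0" "\<And>c. c \<in> C \<Longrightarrow> cmod c \<le> B"
    using compact_imp_bounded[OF assms] unfolding bounded_pos by blast
  have "1 / B \<le> cmod (x n)" for n
  proof -
    have "inverse (cmod (x n)) \<le> B" "0 < cmod (x n)"
      using x B(2)[of "inverse (x n)"] by (auto simp: norm_inverse)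
    then show ?thesis
      using B(1) by (simp add: field_simps)
  qed
  then have "1 / B \<le> cmod l"
    by (intro LIMSEQ_le_const[OF tendsto_norm[OF lim]]) auto
  with B(1) have "l \<noteq> 0"
    by auto
  moreover have "inverse l \<in> C"
    using x closed_sequentially[OF compact_imp_closed[OF assms], of "\<lambda>n. inverse (x n)"]
      tendsto_inverse[OF lim \<open>l \<noteq> 0\<close>] by simp
  ultimately show "l \<in> {a. a \<noteq> 0 \<and> inverse a \<in> C}"
    by simp
qed

lemma inverted_complement_antimono: "A \<subseteq> B \<Longrightarrow> inverted_complement B \<subseteq> inverted_complement A"
  by (auto simp: inverted_complement_def)

lemma open_inverted_complement:
  assumes "compact K" shows "open (inverted_complement K)"
proof -
  have "inverted_complement K = - {a. a \<noteq> 0 \<and> inverse a \<in> K}"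
    by (auto simp: inverted_complement_def)
  then show ?thesis
    using closed_inverse_preimage_compact[OF assms] by (simp add: closed_def)
qed

lemma compact_inverted_complement:
  assumes "open U" "0 \<in> U"
  shows "compact (inverted_complement U)"
proof -
  obtain e where e: "e > 0" "ball 0 e \<subseteq> U"
    using assms openE by blast
  have "cmod r \<le> 1 / e" if "r \<in> inverted_complement U" for r
  proof (cases "r = 0")
    case False
    with that have "inverse r \<notin> ball 0 e"
      using e(2) by (auto simp: inverted_complement_def)
    then have "e \<le> inverse (cmod r)"
      by (simp add: norm_inverse)
    moreover have "0 < cmod r"
      using False by simp
    ultimately show ?thesis
      using e(1) by (simp add: field_simps)
  qed (use e in simp)
  then have "bounded (inverted_complement U)"
    unfolding bounded_iff by blast
  moreover have "open (- inverted_complement U)"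
  proof -
    have "- inverted_complement U = (- {0}) \<inter> inverse -` U"
      by (auto simp: inverted_complement_def)
    moreover have "open (- {0::complex})"
      by (simp add: open_Compl)
    ultimately show ?thesis
      using continuous_open_preimage[of "- {0}" inverse U] assms(1) by (simp add: continuous_on_inverse)
  qed
  ultimately show ?thesis
    by (simp add: compact_eq_bounded_closed closed_def)
qed

text \<open>The exterior of a convex set is the union of rays that lead away from the point \<open>0\<close> of \<open>K\<close>; after
  inversion they become segments that end at \<open>0\<close>.\<close>

lemma simply_connected_inverted_complement:
  assumes "convex K" "0 \<in> K"
  shows "simply_connected (inverted_complement K)"
proof (rule starlike_imp_simply_connected)
  have scale: "of_real t * r \<in> inverted_complement K" if r: "r \<in> inverted_complement K" and t: "0 \<le> t" "t \<le> 1" for t r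
  proof (cases "t = 0 \<or> r = 0")
    case False
    have "inverse (of_real t * r) \<notin> K"
    proof
      assume "inverse (of_real t * r) \<in> K"
      then have "(1 - t) *\<^sub>R 0 + t *\<^sub>R inverse (of_real t * r) \<in> K"
        using assms t by (intro convexD) auto
      moreover have "t *\<^sub>R inverse (of_real t * r) = inverse r"
        using False by (simp add: scaleR_conv_of_real)
      ultimately show False
        using r False by (simp add: inverted_complement_def)
    qed
    then show ?thesis
      by (simp add: inverted_complement_def)
  qed (auto simp: inverted_complement_def)
  have "0 \<in> inverted_complement K"
    by (simp add: inverted_complement_def)
  moreover have "closed_segment 0 r \<subseteq> inverted_complement K" if "r \<in> inverted_complement K" for r
    using scale[OF that] by (auto simp: closed_segment_def scaleR_conv_of_real)
  ultimately show "starlike (inverted_complement K)"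
    unfolding starlike_def by blast
qed

lemma inverted_complement_neq_UNIV: "k \<in> K \<Longrightarrow> k \<noteq> 0 \<Longrightarrow> inverted_complement K \<noteq> UNIV"
proof
  assume k: "k \<in> K" "k \<noteq> 0" "inverted_complement K = UNIV"
  then have "inverse k \<in> inverted_complement K"
    by simp
  then have "inverse k = 0 \<or> inverse (inverse k) \<notin> K"
    by (simp only: inverted_complement_def mem_Collect_eq)
  with k(1,2) show False
    by simp
qed

lemma Riemann_map_at:
  assumes S: "open S" "simply_connected S" "S \<noteq> UNIV" and a: "a \<in> S"
  obtains g where "g holomorphic_on unit_disk" "inj_on g unit_disk" "g ` unit_disk = S" "g 0 = a"
proof -
  obtain f g where f: "\<forall>z\<in>S. f z \<in> unit_disk \<and> g (f z) = z"
    and g: "g holomorphic_on unit_disk" "\<forall>z\<in>unit_disk. g z \<in> S \<and> f (g z) = z"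
    using Riemann_mapping_theorem[of S] S a by auto
  define b where "b = f a"
  have b: "cmod b < 1" "g b = a"
    using f a by (auto simp: b_def)
  let ?T = "Moebius_function 0 (- b)"
  have T: "bij_betw ?T unit_disk unit_disk" "?T holomorphic_on unit_disk"
    using bij_betw_Moebius_function[of "- b"] Moebius_function_holomorphic[of "- b"] b(1) by simp_all
  show thesis
  proof
    show "(g \<circ> ?T) holomorphic_on unit_disk"
      using T by (intro holomorphic_on_compose_gen[OF T(2) g(1)]) (simp add: bij_betw_def)
    have "inj_on g unit_disk"
      using g(2) by (metis inj_onI)
    then show "inj_on (g \<circ> ?T) unit_disk"
      using T(1) by (intro comp_inj_on) (simp_all add: bij_betw_def)
    have "g ` unit_disk = S"
      using f g(2) by (metis image_eqI image_subsetI subsetI subset_antisym)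
    then show "(g \<circ> ?T) ` unit_disk = S"
      using T(1) by (metis bij_betw_def image_comp)
    show "(g \<circ> ?T) 0 = a"
      by (simp add: Moebius_function_of_zero b(2))
  qed
qed

lemma compact_subset_unit_disk:
  assumes "compact C" "C \<subseteq> unit_disk"
  obtains t where "t < 1" "C \<subseteq> cball 0 t"
proof (cases "C = {}")
  case False
  obtain c where "c \<in> C" "\<And>z. z \<in> C \<Longrightarrow> cmod z \<le> cmod c"
    using continuous_attains_sup[OF assms(1) False, of cmod] continuous_on_norm[OF continuous_on_id] by auto
  then have "cmod c < 1" "C \<subseteq> cball 0 (cmod c)"
    using assms(2) by auto
  then show thesis
    by (rule that)
qed (use that[of 0] in simp)

lemma unbounded_complement_of_injective_image:
  assumes f: "f holomorphic_on unit_disk" "inj_on f unit_disk"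
  shows "\<not> bounded (- (f ` unit_disk))"
proof
  assume bdd: "bounded (- (f ` unit_disk))"
  obtain g where g: "g holomorphic_on f ` unit_disk" "\<And>z. z \<in> unit_disk \<Longrightarrow> g (f z) = z"
    using holomorphic_has_inverse[OF f(1) open_ball f(2)] by metis
  have op: "open (f ` unit_disk)"
    by (rule open_mapping_thm3[OF f(1) open_ball f(2)])
  have "simply_connected (f ` unit_disk)"
    unfolding simply_connected_eq_biholomorphic_to_disc[OF op] using f(1) g by (intro disjI2 exI[of _ g] exI[of _ f]) auto
  then have unb: "\<not> bounded C" if "C \<in> components (- (f ` unit_disk))" for C
    using that simply_connected_eq_unbounded_complement_components[OF op] by blast
  \<comment> \<open>An empty complement is excluded by Liouville, a nonempty bounded one by simple connectivity.\<close>
  show False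
  proof (cases "- (f ` unit_disk) = {}")
    case True
    then have UNIV: "f ` unit_disk = UNIV"
      by auto
    have "range g \<subseteq> unit_disk"
      using g(2) by (auto simp: UNIV[symmetric])
    then have "bounded (range g)"
      using bounded_ball bounded_subset by blast
    then have "g constant_on UNIV"
      using Liouville_theorem g(1) UNIV by metis
    then have "g (f 0) = g (f (1/2))"
      unfolding constant_on_def by (metis UNIV_I)
    then show False
      using g(2)[of 0] g(2)[of "1/2"] by simp
  next
    case False
    then obtain C where "C \<in> components (- (f ` unit_disk))"
      by (metis Union_components Union_empty equals0I)
    then show False
      using unb bounded_subset[OF bdd in_components_subset] by blast
  qed
qed

section \<open>Exteriors of compact convex sets\<close>

text \<open>A conformal map onto the exterior of \<open>K\<close> in the sphere has a pole. The holomorphic map \<open>g\<close> is the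
  reciprocal of such a map, and \<open>gi\<close> is the inverse of \<open>g\<close>; the exterior map itself is \<open>h\<close> below, with
  its pole at \<open>0\<close>.\<close>

locale compact_exterior_map =
  fixes K :: "complex set" and g gi :: "complex \<Rightarrow> complex"
  assumes K: "compact K" "convex K" "0 \<in> K"
    and g: "g holomorphic_on unit_disk" "inj_on g unit_disk" "g ` unit_disk = inverted_complement K" "g 0 = 0"
    and gi: "gi holomorphic_on inverted_complement K" "\<And>z. z \<in> unit_disk \<Longrightarrow> gi (g z) = z"

begin

definition h :: "complex \<Rightarrow> complex"
  where "h z = inverse (g z)"

lemma g_gi: "r \<in> inverted_complement K \<Longrightarrow> gi r \<in> unit_disk" "r \<in> inverted_complement K \<Longrightarrow> g (gi r) = r"
  using g(3) gi(2) by (metis imageE)+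

lemma g_nz: "z \<in> unit_disk \<Longrightarrow> z \<noteq> 0 \<Longrightarrow> g z \<noteq> 0"
  using g(2,4) by (metis centre_in_ball inj_onD zero_less_one)

lemma has_field_derivative_gi:
  assumes "z \<in> unit_disk"
  shows "(gi has_field_derivative inverse (deriv g z)) (at (g z))"
proof (rule has_field_derivative_inverse_strong[of g])
  show "(g has_field_derivative deriv g z) (at z)"
    by (rule holomorphic_derivI[OF g(1) open_ball assms])
  show "deriv g z \<noteq> 0"
    by (rule holomorphic_injective_imp_regular[OF g(1) open_ball g(2) assms])
  show "continuous_on unit_disk g"
    by (rule holomorphic_on_imp_continuous_on[OF g(1)])
qed (use assms gi(2) in auto)

lemma h_notin_K: "z \<in> unit_disk \<Longrightarrow> z \<noteq> 0 \<Longrightarrow> h z \<notin> K"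
  using g(3) g_nz[of z] by (auto simp: h_def inverted_complement_def)

lemma inverse_in_inverted_complement: "a \<notin> K \<Longrightarrow> inverse a \<in> inverted_complement K"
  by (simp add: inverted_complement_def)

lemma holomorphic_on_h: "h holomorphic_on (unit_disk - {0})"
  unfolding h_def[abs_def] using g(1) g_nz by (auto intro!: holomorphic_intros intro: holomorphic_on_subset)

lemma h_near_boundary:
  assumes U: "open U" "K \<subseteq> U"
  obtains t where "t < 1" "\<And>z. z \<in> unit_disk \<Longrightarrow> t < cmod z \<Longrightarrow> h z \<in> U"
proof -
  have Z: "compact (inverted_complement U)"
    using U K(3) by (intro compact_inverted_complement) auto
  have sub: "inverted_complement U \<subseteq> inverted_complement K"
    using U(2) by (auto simp: inverted_complement_def)
  have "compact (gi ` inverted_complement U)"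
    using Z sub gi(1) by (meson compact_continuous_image continuous_on_subset holomorphic_on_imp_continuous_on)
  then obtain t where t: "t < 1" "gi ` inverted_complement U \<subseteq> cball 0 t"
    using sub g_gi(1) by (elim compact_subset_unit_disk) blast+
  have "h z \<in> U" if "z \<in> unit_disk" "t < cmod z" for z
  proof (rule ccontr)
    assume "h z \<notin> U"
    then have "g z \<in> inverted_complement U"
      by (simp add: inverted_complement_def h_def)
    then have "gi (g z) \<in> cball 0 t"
      using t(2) by blast
    with that gi(2) show False
      by simp
  qed
  with t(1) that show thesis
    by blast
qed

definition rot_mean :: "real \<Rightarrow> complex \<Rightarrow> complex"
  where "rot_mean \<alpha> z = (h (cis \<alpha> * z) + h (cis (- \<alpha>) * z)) / 2"

lemma rot_in_punctured_disk: "z \<in> unit_disk - {0} \<Longrightarrow> cis \<alpha> * z \<in> unit_disk - {0}"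
  by (auto simp: norm_mult)

lemma holomorphic_on_rot_mean: "rot_mean \<alpha> holomorphic_on (unit_disk - {0})"
proof -
  have "(\<lambda>z. h (cis \<beta> * z)) holomorphic_on (unit_disk - {0})" for \<beta>
  proof -
    have "h \<circ> (\<lambda>z. cis \<beta> * z) holomorphic_on (unit_disk - {0})"
      by (rule holomorphic_on_compose_gen[OF _ holomorphic_on_h])
        (use rot_in_punctured_disk in \<open>auto intro!: holomorphic_intros\<close>)
    then show ?thesis
      by (simp add: o_def)
  qed
  then show ?thesis
    unfolding rot_mean_def[abs_def] by (intro holomorphic_intros) auto
qed

text \<open>Near its pole \<open>h\<close> is \<open>1 / (D z)\<close> up to lower order terms, whence the mean is \<open>cos \<alpha> / (D z)\<close>. Its
  preimage therefore has modulus larger than \<open>\<bar>z\<bar>\<close> near \<open>0\<close>, so the pole does no harm to the maximum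
  principle below.\<close>

lemma rot_mean_ratio_at_0:
  assumes "0 < cos \<alpha>"
  shows "((\<lambda>z. gi (inverse (rot_mean \<alpha> z)) / z) \<longlongrightarrow> of_real (1 / cos \<alpha>)) (at 0)"
proof -
  define D where "D = deriv g 0"
  have dg: "(g has_field_derivative D) (at 0)"
    unfolding D_def by (rule holomorphic_derivI[OF g(1)]) auto
  have D: "D \<noteq> 0"
    unfolding D_def by (rule holomorphic_injective_imp_regular[OF g(1) open_ball g(2)]) simp
  have quot: "((\<lambda>z. g (cis \<beta> * z) / z) \<longlongrightarrow> D * cis \<beta>) (at 0)" for \<beta>
  proof -
    have "((\<lambda>z. g (cis \<beta> * z)) has_field_derivative D * cis \<beta>) (at 0)"
      by (rule DERIV_chain2[of g]) (use dg in \<open>auto intro!: derivative_eq_intros\<close>)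
    then show ?thesis
      by (simp add: has_field_derivative_iff g(4))
  qed
  define M where "M z = inverse (rot_mean \<alpha> z)" for z
  have cis_sum: "cis \<alpha> + cis (- \<alpha>) = of_real (2 * cos \<alpha>)"
    by (simp add: complex_eq_iff)
  have cis_prod: "cis \<alpha> * cis (- \<alpha>) = 1"
    by (simp add: cis_mult)
  have "((\<lambda>z. 2 * (g (cis \<alpha> * z) / z) * (g (cis (- \<alpha>) * z) / z) / (g (cis \<alpha> * z) / z + g (cis (- \<alpha>) * z) / z))
      \<longlongrightarrow> 2 * (D * cis \<alpha>) * (D * cis (- \<alpha>)) / (D * cis \<alpha> + D * cis (- \<alpha>))) (at 0)"
    using D assms by (intro tendsto_intros quot) (simp add: cis_sum flip: distrib_left)
  also have "2 * (D * cis \<alpha>) * (D * cis (- \<alpha>)) / (D * cis \<alpha> + D * cis (- \<alpha>)) = D / of_real (cos \<alpha>)"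
  proof -
    have "2 * (D * cis \<alpha>) * (D * cis (- \<alpha>)) = 2 * D * D * (cis \<alpha> * cis (- \<alpha>))"
      by (simp only: mult_ac)
    also have "\<dots> = 2 * D * D"
      by (simp add: cis_prod)
    finally show ?thesis
      unfolding distrib_left[symmetric] cis_sum using D assms by (simp add: field_simps)
  qed
  finally have limit: "((\<lambda>z. 2 * (g (cis \<alpha> * z) / z) * (g (cis (- \<alpha>) * z) / z) / (g (cis \<alpha> * z) / z + g (cis (- \<alpha>) * z) / z))
      \<longlongrightarrow> D / of_real (cos \<alpha>)) (at 0)" .
  have "eventually (\<lambda>z. z \<in> unit_disk - {0}) (at 0)"
    using eventually_at_in_open[of unit_disk 0] by simp
  then have "eventually (\<lambda>z. 2 * (g (cis \<alpha> * z) / z) * (g (cis (- \<alpha>) * z) / z) / (g (cis \<alpha> * z) / z + g (cis (- \<alpha>) * z) / z)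
      = M z / z) (at 0)"
  proof eventually_elim
    case (elim z)
    then have "g (cis \<alpha> * z) \<noteq> 0" "g (cis (- \<alpha>) * z) \<noteq> 0" "z \<noteq> 0"
      using g_nz rot_in_punctured_disk by blast+
    then show ?case
      by (cases "g (cis \<alpha> * z) + g (cis (- \<alpha>) * z) = 0")
        (simp_all add: M_def rot_mean_def h_def field_simps)
  qed
  with limit have M_lim: "((\<lambda>z. M z / z) \<longlongrightarrow> D / of_real (cos \<alpha>)) (at 0)"
    by (rule Lim_transform_eventually)
  have "((\<lambda>z. M z / z * z) \<longlongrightarrow> D / of_real (cos \<alpha>) * 0) (at 0)"
    by (intro tendsto_mult M_lim tendsto_ident_at)
  moreover have "eventually (\<lambda>z. M z / z * z = M z) (at 0)"
    by (simp add: eventually_at_filter)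
  ultimately have "(M \<longlongrightarrow> D / of_real (cos \<alpha>) * 0) (at 0)"
    by (rule Lim_transform_eventually)
  then have M_0: "(M \<longlongrightarrow> 0) (at 0)"
    by simp
  have "D / of_real (cos \<alpha>) \<noteq> 0"
    using D assms by simp
  with M_lim have "eventually (\<lambda>z. M z / z \<noteq> 0) (at 0)"
    by (rule tendsto_imp_eventually_ne)
  then have M_nz: "eventually (\<lambda>z. M z \<noteq> 0) (at 0)"
    by eventually_elim auto
  have dgi: "(gi has_field_derivative inverse D) (at 0)"
    using has_field_derivative_gi[of 0] by (simp add: g(4) D_def)
  have gi0: "gi 0 = 0"
    using gi(2)[of 0] g(4) by simp
  have "((\<lambda>r. gi r / r) \<longlongrightarrow> inverse D) (at 0)"
    using dgi by (simp add: has_field_derivative_iff gi0)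
  moreover have "filterlim M (at 0) (at 0)"
    using M_0 M_nz by (simp add: filterlim_at)
  ultimately have "((\<lambda>z. gi (M z) / M z) \<longlongrightarrow> inverse D) (at 0)"
    by (rule filterlim_compose)
  with M_lim have "((\<lambda>z. gi (M z) / M z * (M z / z)) \<longlongrightarrow> inverse D * (D / of_real (cos \<alpha>))) (at 0)"
    by (rule tendsto_mult[rotated])
  also have "inverse D * (D / of_real (cos \<alpha>)) = of_real (1 / cos \<alpha>)"
    using D by (simp add: field_simps)
  finally have "((\<lambda>z. gi (M z) / M z * (M z / z)) \<longlongrightarrow> of_real (1 / cos \<alpha>)) (at 0)" .
  moreover have "eventually (\<lambda>z. gi (M z) / M z * (M z / z) = gi (M z) / z) (at 0)"
    using M_nz by eventually_elim simp
  ultimately have "((\<lambda>z. gi (M z) / z) \<longlongrightarrow> of_real (1 / cos \<alpha>)) (at 0)"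
    by (rule Lim_transform_eventually)
  then show ?thesis
    by (simp add: M_def)
qed

text \<open>With \<open>k z\<close> the preimage of the mean, \<open>z / k z\<close> is holomorphic where the mean lies outside \<open>K\<close>, and
  its boundary values have modulus at most one: at the circle because the mean tends to the convex set
  \<open>K\<close>, and where the mean enters \<open>K\<close> because \<open>k\<close> tends to the circle there. The proof replaces
  boundary values by the compactness of the set on which the ratio is at most a fixed \<open>t < 1\<close>.\<close>

lemma cmod_le_preimage_rot_mean:
  assumes \<alpha>: "0 < cos \<alpha>" and z1: "z1 \<in> unit_disk - {0}" "rot_mean \<alpha> z1 \<notin> K"
  shows "cmod z1 \<le> cmod (gi (inverse (rot_mean \<alpha> z1)))"
proof (rule ccontr)
  assume neg: "\<not> ?thesis"
  define k where "k z = gi (inverse (rot_mean \<alpha> z))" for z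
  define E where "E = (unit_disk - {0}) \<inter> rot_mean \<alpha> -` (- K)"
  define t where "t = cmod (k z1) / cmod z1"
  have t: "0 \<le> t" "t < 1"
    using neg z1 by (auto simp: t_def k_def divide_less_eq)
  have cont: "continuous_on (unit_disk - {0}) (rot_mean \<alpha>)"
    by (rule holomorphic_on_imp_continuous_on[OF holomorphic_on_rot_mean])
  have E: "z \<in> unit_disk" "z \<noteq> 0" "rot_mean \<alpha> z \<notin> K" "rot_mean \<alpha> z \<noteq> 0" if "z \<in> E" for z
    using that K(3) by (auto simp: E_def)
  have "open E"
    unfolding E_def by (intro continuous_open_preimage cont) (auto simp: open_Compl compact_imp_closed K(1))
  have g_k: "g (k z) = inverse (rot_mean \<alpha> z)" "k z \<in> unit_disk" if "z \<in> E" for z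
    using g_gi inverse_in_inverted_complement[OF E(3)[OF that]] by (simp_all add: k_def)
  have k_nz: "k z \<noteq> 0" if "z \<in> E" for z
    using g_k(1)[OF that] E(4)[OF that] g(4) by auto
  have hol_k: "k holomorphic_on E"
  proof -
    have "(\<lambda>z. inverse (rot_mean \<alpha> z)) holomorphic_on E"
      using E by (intro holomorphic_intros holomorphic_on_subset[OF holomorphic_on_rot_mean]) auto
    then have "gi \<circ> (\<lambda>z. inverse (rot_mean \<alpha> z)) holomorphic_on E"
      using E(3) inverse_in_inverted_complement by (intro holomorphic_on_compose_gen[OF _ gi(1)]) auto
    then show ?thesis
      by (simp add: o_def k_def[abs_def])
  qed
  \<comment> \<open>All candidates for a smaller ratio have their preimage in the disk of radius t < 1, so their mean stays
    away from K. The convex neighbourhood U of K separates the two.\<close>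
  define C where "C = g ` cball 0 t"
  have t_disk: "cball 0 t \<subseteq> unit_disk"
    using t by auto
  have C: "compact C" "C \<subseteq> inverted_complement K"
    unfolding C_def
    using compact_continuous_image[OF continuous_on_subset[OF holomorphic_on_imp_continuous_on[OF g(1)] t_disk]]
      t_disk g(3) by auto
  define C' where "C' = {a. a \<noteq> 0 \<and> inverse a \<in> C}"
  have C': "closed C'" "K \<inter> C' = {}"
    using closed_inverse_preimage_compact[OF C(1)] C(2) by (auto simp: C'_def inverted_complement_def)
  obtain d where d: "d > 0" "\<And>x y. x \<in> K \<Longrightarrow> y \<in> C' \<Longrightarrow> d \<le> dist x y"
    using separate_compact_closed[OF K(1) C'] by blast
  define U where "U = (\<Union>x\<in>K. \<Union>y\<in>ball 0 d. {x + y})"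
  have "open U" "convex U"
    unfolding U_def by (auto intro!: open_sums convex_sums K(2))
  have "K \<subseteq> U"
    using d(1) by (force simp: U_def)
  have "U \<inter> C' = {}"
  proof -
    have False if "x \<in> K" "y \<in> ball 0 d" "x + y \<in> C'" for x y
      using d(2)[OF that(1,3)] that(2) by (simp add: dist_norm)
    then show ?thesis
      by (auto simp: U_def)
  qed
  obtain t' where t': "t' < 1" "\<And>z. z \<in> unit_disk \<Longrightarrow> t' < cmod z \<Longrightarrow> h z \<in> U"
    using h_near_boundary[OF \<open>open U\<close> \<open>K \<subseteq> U\<close>] by blast
  obtain \<rho> where \<rho>: "\<rho> > 0" "\<And>z. z \<noteq> 0 \<Longrightarrow> cmod z < \<rho> \<Longrightarrow> t < cmod (k z / z)"
  proof -
    have "t < cmod (of_real (1 / cos \<alpha>) :: complex)"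
    proof -
      have "1 \<le> 1 / cos \<alpha>"
        using \<alpha> by simp
      with t(2) \<alpha> show ?thesis
        by (simp only: norm_of_real)
    qed
    then have "eventually (\<lambda>z. t < cmod (k z / z)) (at 0)"
      using order_tendstoD(1)[OF tendsto_norm[OF rot_mean_ratio_at_0[OF \<alpha>]]] by (simp add: k_def)
    then show thesis
      using that unfolding eventually_at by auto
  qed
  define X where "X = {z \<in> E. cmod (k z) \<le> t * cmod z}"
  define N :: "complex set" where "N = cball 0 t' - ball 0 \<rho>"
  have N: "compact N" "N \<subseteq> unit_disk - {0}"
    using t'(1) \<rho>(1) by (auto simp: N_def intro!: compact_diff)
  define Y where "Y = N \<inter> rot_mean \<alpha> -` C'"
  have "closed Y"
    unfolding Y_def using compact_imp_closed[OF N(1)] N(2) C'(1)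
    by (intro continuous_closed_preimage continuous_on_subset[OF cont])
  have "Y \<subseteq> E"
    using N(2) C'(2) by (auto simp: Y_def E_def)
  have "X \<subseteq> Y"
  proof
    fix z assume "z \<in> X"
    then have z: "z \<in> E" "cmod (k z) \<le> t * cmod z"
      by (auto simp: X_def)
    have "t * cmod z \<le> t * 1"
      using E(1)[OF z(1)] t(1) by (intro mult_left_mono) auto
    then have "inverse (rot_mean \<alpha> z) \<in> C"
      using z(2) by (auto simp: C_def g_k(1)[OF z(1), symmetric])
    then have in_C': "rot_mean \<alpha> z \<in> C'"
      using E(4)[OF z(1)] by (simp add: C'_def)
    moreover have "\<not> t' < cmod z"
    proof
      assume far: "t' < cmod z"
      have "h (cis \<beta> * z) \<in> U" for \<beta>
        using t'(2)[of "cis \<beta> * z"] E(1)[OF z(1)] far by (simp add: norm_mult)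
      \<comment> \<open>Convexity of K enters here: near the boundary of the disk the mean of two points of U is again in U.\<close>
      then have "(1 / 2) *\<^sub>R h (cis \<alpha> * z) + (1 / 2) *\<^sub>R h (cis (- \<alpha>) * z) \<in> U"
        by (intro convexD[OF \<open>convex U\<close>]) auto
      moreover have "(1 / 2) *\<^sub>R h (cis \<alpha> * z) + (1 / 2) *\<^sub>R h (cis (- \<alpha>) * z) = rot_mean \<alpha> z"
        by (simp add: rot_mean_def scaleR_conv_of_real field_simps)
      ultimately show False
        using in_C' \<open>U \<inter> C' = {}\<close> by auto
    qed
    moreover have "\<not> cmod z < \<rho>"
      using \<rho>(2)[of z] z(2) E(2)[OF z(1)] by (auto simp: norm_divide field_simps)
    ultimately show "z \<in> Y"
      by (auto simp: Y_def N_def)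
  qed
  have cont_k: "continuous_on E k"
    by (rule holomorphic_on_imp_continuous_on[OF hol_k])
  have "X = Y \<inter> (\<lambda>z. cmod (k z) - t * cmod z) -` {..0}"
    using \<open>X \<subseteq> Y\<close> \<open>Y \<subseteq> E\<close> by (auto simp: X_def)
  moreover have "closed (Y \<inter> (\<lambda>z. cmod (k z) - t * cmod z) -` {..0})"
    using \<open>closed Y\<close> by (intro continuous_closed_preimage continuous_intros continuous_on_subset[OF cont_k \<open>Y \<subseteq> E\<close>]) auto
  moreover have "bounded X"
    using bounded_subset[OF compact_imp_bounded[OF N(1)], of X] \<open>X \<subseteq> Y\<close> by (auto simp: Y_def)
  ultimately have "compact X"
    by (simp add: compact_eq_bounded_closed)
  have "X \<subseteq> E"
    by (auto simp: X_def)
  define \<phi> where "\<phi> z = cmod (k z) / cmod z" for z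
  have cont_\<phi>: "continuous_on X \<phi>"
    unfolding \<phi>_def[abs_def] using \<open>X \<subseteq> E\<close> E(2)
    by (intro continuous_intros continuous_on_subset[OF cont_k \<open>X \<subseteq> E\<close>]) auto
  have "z1 \<in> X"
    using z1 by (simp add: X_def E_def t_def)
  then obtain z0 where z0: "z0 \<in> X" "\<And>z. z \<in> X \<Longrightarrow> \<phi> z0 \<le> \<phi> z"
    using continuous_attains_inf[OF \<open>compact X\<close> _ cont_\<phi>] by blast
  have z0_E: "z0 \<in> E"
    using z0(1) \<open>X \<subseteq> E\<close> by blast
  have m_pos: "0 < \<phi> z0"
    using k_nz[OF z0_E] E(2)[OF z0_E] by (simp add: \<phi>_def)
  have X_iff: "z \<in> X \<longleftrightarrow> \<phi> z \<le> t" if "z \<in> E" for z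
    using E(2)[OF that] that by (simp add: X_def \<phi>_def divide_le_eq)
  have min: "\<phi> z0 \<le> \<phi> z" if "z \<in> E" for z
    using X_iff[OF that] X_iff[OF z0_E] z0 by fastforce
  \<comment> \<open>The set where the least ratio is attained is closed, and open by the maximum principle applied to
    z / k z, which is impossible for a nonempty bounded set.\<close>
  define M where "M = X \<inter> \<phi> -` {\<phi> z0}"
  have M_iff: "z \<in> M \<longleftrightarrow> z \<in> E \<and> \<phi> z = \<phi> z0" for z
    using X_iff X_iff[OF z0_E] z0(1) \<open>X \<subseteq> E\<close> by (auto simp: M_def)
  have "closed M"
    unfolding M_def using \<open>compact X\<close> by (intro continuous_closed_preimage cont_\<phi> compact_imp_closed) auto
  moreover have "open M"
    unfolding open_contains_ball
  proof
    fix z assume "z \<in> M"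
    then have z: "z \<in> E" "\<phi> z = \<phi> z0"
      by (auto simp: M_iff)
    obtain e where e: "e > 0" "ball z e \<subseteq> E"
      using \<open>open E\<close> z(1) openE by blast
    define q where "q w = w / k w" for w
    have q: "cmod (q w) = inverse (\<phi> w)" for w
      by (simp add: q_def \<phi>_def norm_divide)
    have "q constant_on ball z e"
    proof (rule maximum_modulus_principle[of _ _ "ball z e" z])
      show "q holomorphic_on ball z e"
        unfolding q_def[abs_def] using e(2) k_nz by (intro holomorphic_intros holomorphic_on_subset[OF hol_k]) auto
      show "cmod (q w) \<le> cmod (q z)" if "w \<in> ball z e" for w
        using min[of w] that e(2) z(2) m_pos by (auto simp: q intro!: le_imp_inverse_le)
    qed (use e in auto)
    then have "q w = q z" if "w \<in> ball z e" for w
      using that e(1) unfolding constant_on_def by (metis centre_in_ball)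
    then have "\<phi> w = \<phi> z" if "w \<in> ball z e" for w
      using q that by (metis inverse_inverse_eq)
    then have "ball z e \<subseteq> M"
      using e(2) z(2) by (auto simp: M_iff)
    with e(1) show "\<exists>e>0. ball z e \<subseteq> M"
      by blast
  qed
  moreover have "z0 \<in> M"
    using z0_E by (simp add: M_iff)
  ultimately have "M = UNIV"
    using clopen[of M] by auto
  then have "1 \<in> E"
    by (metis M_iff UNIV_I)
  then show False
    by (auto simp: E_def)
qed

text \<open>By the preceding lemma the logarithm of the modulus of the preimage of the mean has a minimum at
  \<open>\<alpha> = 0\<close>. Its second derivative there is minus the real part of the pre-Schwarzian of \<open>h\<close> in
  logarithmic coordinates.\<close>

lemma Re_pre_schwarzian_h:
  assumes z: "z \<in> unit_disk - {0}"
  shows "Re (1 + z * pre_schwarzian h z) \<le> 0"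
proof -
  define s0 where "s0 = Ln z"
  have exp_s0: "exp s0 = z"
    using z by (simp add: s0_def)
  have g_z: "g z \<noteq> 0" and hz: "h z \<notin> K" "h z \<noteq> 0" "inverse (h z) = g z" and gi_z: "gi (g z) = z"
    using z g_nz h_notin_K K(3) gi(2) by (auto simp: h_def)
  have ana_h: "h analytic_on {z}"
    using z holomorphic_on_h by (auto simp: analytic_at intro!: exI[of _ "unit_disk - {0}"])
  have ana_gi: "gi analytic_on {g z}"
    using gi(1) g(3) open_inverted_complement[OF K(1)] z by (auto simp: analytic_at intro!: exI[of _ "inverted_complement K"])
  have dg: "(g has_field_derivative deriv g z) (at z)" "deriv g z \<noteq> 0"
    using holomorphic_derivI[OF g(1) open_ball] holomorphic_injective_imp_regular[OF g(1) open_ball g(2)] z by auto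
  have "(h has_field_derivative - (inverse (g z) * deriv g z * inverse (g z))) (at z)"
    unfolding h_def[abs_def] by (rule DERIV_inverse'[OF dg(1) g_z])
  then have dh: "deriv h z = - deriv g z / (g z)\<^sup>2"
    by (simp add: DERIV_imp_deriv field_simps power2_eq_square)
  \<comment> \<open>In the logarithmic coordinate s = Ln z rotations become translations along the imaginary axis.\<close>
  define H where "H s = h (exp s)" for s
  have ana_H: "H analytic_on {s0}"
  proof -
    have "h \<circ> exp analytic_on {s0}"
      by (rule analytic_on_compose) (use ana_h exp_s0 in \<open>auto intro: analytic_intros\<close>)
    then show ?thesis
      by (simp add: o_def H_def[abs_def])
  qed
  have dH: "deriv H s0 = deriv h z * z"
  proof -
    have "((\<lambda>s. h (exp s)) has_field_derivative deriv h z * z) (at s0)"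
      by (rule DERIV_chain2[where g = exp])
        (use analytic_derivI[OF ana_h] DERIV_exp[of s0] exp_s0 in simp_all)
    then show ?thesis
      by (simp add: H_def[abs_def] DERIV_imp_deriv)
  qed
  have dH_nz: "deriv H s0 \<noteq> 0"
    using dh dg(2) g_z z by (simp add: dH)
  have pre_H: "pre_schwarzian H s0 = pre_schwarzian h z * z + 1"
  proof -
    have "deriv exp = (exp :: complex \<Rightarrow> complex)"
      by (rule ext) (simp add: DERIV_imp_deriv)
    then have "pre_schwarzian exp s0 = 1"
      by (simp add: pre_schwarzian_def)
    moreover have "pre_schwarzian H s0 = pre_schwarzian h (exp s0) * deriv exp s0 + pre_schwarzian exp s0"
      unfolding H_def[abs_def] using ana_h exp_s0 dh dg(2) g_z z \<open>deriv exp = exp\<close>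
      by (intro pre_schwarzian_compose) (auto intro: analytic_intros)
    ultimately show ?thesis
      using exp_s0 \<open>deriv exp = exp\<close> by simp
  qed
  define Y where "Y \<alpha> = (H (s0 + \<i> * \<alpha>) + H (s0 - \<i> * \<alpha>)) / 2" for \<alpha>
  have Y_0: "Y 0 = h z"
    by (simp add: Y_def H_def exp_s0)
  have Y_real: "Y (of_real \<alpha>) = rot_mean \<alpha> z" for \<alpha>
  proof -
    have "exp (s0 + \<i> * of_real \<alpha>) = cis \<alpha> * z" "exp (s0 - \<i> * of_real \<alpha>) = cis (- \<alpha>) * z"
      by (simp_all add: exp_add exp_diff exp_s0 cis_conv_exp exp_minus field_simps)
    then show ?thesis
      by (simp add: Y_def H_def rot_mean_def)
  qed
  have shift: "(\<lambda>\<alpha>. H (s0 + c * \<alpha>)) analytic_on {0}" for c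
  proof -
    have "H \<circ> (\<lambda>\<alpha>. s0 + c * \<alpha>) analytic_on {0}"
      by (rule analytic_on_compose) (use ana_H in \<open>auto intro!: analytic_intros\<close>)
    then show ?thesis
      by (simp add: o_def)
  qed
  have ana_Y: "Y analytic_on {0}"
    using shift[of \<i>] shift[of "- \<i>"] unfolding Y_def[abs_def] by (auto intro!: analytic_intros)
  have "eventually (\<lambda>\<alpha>. H analytic_on {s0 + c * \<alpha>}) (nhds 0)" for c
  proof (rule eventually_compose_filterlim[OF eventually_analytic_at[OF ana_H]])
    show "filterlim (\<lambda>\<alpha>. s0 + c * \<alpha>) (nhds s0) (nhds 0)"
      by (auto intro!: tendsto_eq_intros filterlim_ident)
  qed
  from this[of \<i>] this[of "- \<i>"]
  have ev: "eventually (\<lambda>\<alpha>. deriv Y \<alpha> = (deriv H (s0 + \<i> * \<alpha>) * \<i> + deriv H (s0 - \<i> * \<alpha>) * (- \<i>)) / 2) (nhds 0)"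
  proof eventually_elim
    case (elim \<alpha>)
    have "((\<lambda>\<alpha>. H (s0 + c * \<alpha>)) has_field_derivative deriv H (s0 + c * \<alpha>) * c) (at \<alpha>)"
      if "H analytic_on {s0 + c * \<alpha>}" for c
      by (rule DERIV_chain2[where g = "\<lambda>\<alpha>. s0 + c * \<alpha>"])
        (use analytic_derivI[OF that] in \<open>auto intro!: derivative_eq_intros\<close>)
    from this[OF elim(1)] this[OF elim(2)] show ?case
      unfolding Y_def[abs_def] by (intro DERIV_imp_deriv) (auto intro!: derivative_eq_intros)
  qed
  have dY: "deriv Y 0 = 0"
    using eventually_nhds_x_imp_x[OF ev] by simp
  have d2Y: "deriv (deriv Y) 0 = - deriv (deriv H) s0"
  proof -
    have "((\<lambda>\<alpha>. deriv H (s0 + c * \<alpha>)) has_field_derivative deriv (deriv H) s0 * c) (at 0)" for c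
      by (rule DERIV_chain2[where g = "\<lambda>\<alpha>. s0 + c * \<alpha>"])
        (use analytic_derivI[OF analytic_deriv[OF ana_H]] in \<open>auto intro!: derivative_eq_intros\<close>)
    from this[of \<i>] this[of "- \<i>"]
    have "((\<lambda>\<alpha>. (deriv H (s0 + \<i> * \<alpha>) * \<i> + deriv H (s0 - \<i> * \<alpha>) * (- \<i>)) / 2) has_field_derivative
        - deriv (deriv H) s0) (at 0)"
      by (auto intro!: derivative_eq_intros)
    then show ?thesis
      by (simp add: DERIV_imp_deriv deriv_cong_ev[OF ev refl])
  qed
  \<comment> \<open>Division by z puts the argument of the logarithm near 1, where the principal branch is analytic.\<close>
  define \<phi> where "\<phi> a = - Ln (gi (inverse a) / z)" for a
  have ana_\<phi>: "\<phi> analytic_on {h z}"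
  proof -
    have inv: "inverse analytic_on {h z}"
      using hz by (auto intro!: analytic_intros)
    then have "gi \<circ> inverse analytic_on {h z}"
      by (rule analytic_on_compose) (use ana_gi hz in simp)
    then have "(\<lambda>a. gi (inverse a)) analytic_on {h z}"
      by (simp add: o_def)
    then show ?thesis
      unfolding \<phi>_def[abs_def] using hz gi_z z by (intro analytic_intros) auto
  qed
  have d\<phi>: "deriv \<phi> (h z) * deriv H s0 = - 1"
  proof -
    have "(inverse has_field_derivative - (inverse (h z) * 1 * inverse (h z))) (at (h z))"
      by (rule DERIV_inverse'[OF DERIV_ident hz(2)])
    then have "((\<lambda>a. gi (inverse a)) has_field_derivative inverse (deriv g z) * - (g z)\<^sup>2) (at (h z))"
      using has_field_derivative_gi[of z] z hz(3)
      by (intro DERIV_chain2[where g = inverse]) (auto simp: power2_eq_square)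
    then have "(\<phi> has_field_derivative - (inverse (deriv g z) * - (g z)\<^sup>2 / z)) (at (h z))"
      unfolding \<phi>_def[abs_def] using hz gi_z z by (auto intro!: derivative_eq_intros)
    then have "deriv \<phi> (h z) = (g z)\<^sup>2 / (z * deriv g z)"
      by (simp add: DERIV_imp_deriv field_simps)
    then show ?thesis
      unfolding dH dh using z dg(2) g_z by (simp add: field_simps)
  qed
  define \<kappa> where "\<kappa> \<alpha> = \<phi> (Y \<alpha>)" for \<alpha>
  have ana_\<kappa>: "\<kappa> analytic_on {0}"
  proof -
    have "\<phi> \<circ> Y analytic_on {0}"
      by (rule analytic_on_compose[OF ana_Y]) (use ana_\<phi> Y_0 in simp)
    then show ?thesis
      by (simp add: o_def \<kappa>_def[abs_def])
  qed
  have \<kappa>_0: "\<kappa> 0 = 0"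
    using hz gi_z z by (simp add: \<kappa>_def \<phi>_def Y_0)
  have "eventually (\<lambda>\<alpha>::real. Re (\<kappa> (of_real \<alpha>)) \<le> Re (\<kappa> 0)) (nhds 0)"
  proof -
    have lim: "filterlim (\<lambda>\<alpha>. Y (of_real \<alpha>)) (nhds (h z)) (nhds (0::real))"
    proof -
      have "(Y \<longlongrightarrow> Y 0) (nhds 0)"
        using analytic_at_imp_isCont[OF ana_Y] isCont_def tendsto_at_iff_tendsto_nhds by blast
      then show ?thesis
        unfolding Y_0 by (rule filterlim_compose) (use tendsto_of_real[OF filterlim_ident, of 0] in simp)
    qed
    have "eventually (\<lambda>a. a \<in> - K) (nhds (h z))"
      using hz(1) K(1) by (intro eventually_nhds_in_open) (auto simp: open_Compl compact_imp_closed)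
    from eventually_compose_filterlim[OF this lim]
    have "eventually (\<lambda>\<alpha>. Y (of_real \<alpha>) \<in> - K) (nhds (0::real))" .
    moreover have "eventually (\<lambda>\<alpha>::real. 0 < cos \<alpha>) (nhds 0)"
    proof -
      have "(cos \<longlongrightarrow> cos 0) (nhds (0::real))"
        by (intro tendsto_intros filterlim_ident)
      then show ?thesis
        by (rule order_tendstoD) simp
    qed
    ultimately show ?thesis
    proof eventually_elim
      case (elim \<alpha>)
      define k where "k = gi (inverse (rot_mean \<alpha> z))"
      have "cmod z \<le> cmod k"
        unfolding k_def using cmod_le_preimage_rot_mean[OF elim(2) z] elim(1) by (simp add: Y_real)
      moreover have "0 < cmod z"
        using z by simp
      ultimately have "1 \<le> cmod (k / z)" "k / z \<noteq> 0"
        by (auto simp: norm_divide)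
      then have "0 \<le> Re (Ln (k / z))"
        by simp
      then show ?case
        by (simp add: \<kappa>_0) (simp add: \<kappa>_def \<phi>_def Y_real k_def)
    qed
  qed
  from Re_local_max_second_order(2)[OF ana_\<kappa> this]
  have "Re (deriv (deriv \<kappa>) 0) \<le> 0" .
  moreover have "deriv (deriv \<kappa>) 0 = pre_schwarzian H s0"
  proof -
    have "deriv (deriv \<kappa>) 0 = deriv \<phi> (h z) * - deriv (deriv H) s0"
      unfolding \<kappa>_def[abs_def] using deriv2_compose_at_critical_point[of \<phi> Y 0] ana_\<phi> ana_Y dY d2Y Y_0 by simp
    also have "deriv \<phi> (h z) = - 1 / deriv H s0"
      unfolding nonzero_eq_divide_eq[OF dH_nz] by (rule d\<phi>)
    also have "- 1 / deriv H s0 * - deriv (deriv H) s0 = pre_schwarzian H s0"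
      by (simp add: pre_schwarzian_def)
    finally show ?thesis .
  qed
  ultimately show ?thesis
    by (simp add: pre_H algebra_simps)
qed

text \<open>For \<open>X = z h'' / h'\<close> and \<open>\<rho> = \<bar>z\<bar>\<close> one has \<open>z A\<^sub>h = (1 - \<rho>\<^sup>2) X / 2 - \<rho>\<^sup>2\<close>, and \<open>Re X \<le> - 1\<close> yields
  a real part of at most \<open>- (1 + \<rho>\<^sup>2) / 2 \<le> - \<rho>\<close>.\<close>

lemma A_op_h_ge_1:
  assumes z: "z \<in> unit_disk - {0}"
  shows "1 \<le> cmod (A_op h z)"
proof -
  define \<rho> where "\<rho> = cmod z"
  have \<rho>: "0 < \<rho>" "\<rho> < 1"
    using z by (auto simp: \<rho>_def)
  have "Re (z * pre_schwarzian h z) \<le> - 1"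
    using Re_pre_schwarzian_h[OF z] by simp
  then have bound: "(1 - \<rho>\<^sup>2) * Re (z * pre_schwarzian h z) \<le> (1 - \<rho>\<^sup>2) * - 1"
    using \<rho> by (intro mult_left_mono) (auto simp: abs_square_le_1)
  have "z * A_op h z = of_real ((1 - \<rho>\<^sup>2) / 2) * (z * pre_schwarzian h z) - of_real (\<rho>\<^sup>2)"
    unfolding A_op_def \<rho>_def complex_norm_square by (simp add: algebra_simps complex_norm_square)
  moreover have "Re (of_real a * u - of_real b) = a * Re u - b" for a b u
    by simp
  ultimately have "Re (z * A_op h z) = (1 - \<rho>\<^sup>2) / 2 * Re (z * pre_schwarzian h z) - \<rho>\<^sup>2"
    by (simp only:)
  with bound have "Re (z * A_op h z) \<le> - ((1 + \<rho>\<^sup>2) / 2)"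
    by (simp add: field_simps)
  then have "(1 + \<rho>\<^sup>2) / 2 \<le> cmod (z * A_op h z)"
    using abs_Re_le_cmod[of "z * A_op h z"] by linarith
  moreover have "\<rho> \<le> (1 + \<rho>\<^sup>2) / 2"
    using sum_squares_bound[of 1 \<rho>] by simp
  ultimately have "\<rho> * 1 \<le> \<rho> * cmod (A_op h z)"
    by (simp add: norm_mult \<rho>_def)
  then show ?thesis
    using \<rho>(1) by (simp only: mult_le_cancel_left_pos)
qed

end

text \<open>The origin of the disk is moved from the pole to a preimage of \<open>\<rho>\<close>, that is, from infinity to a
  finite point of the exterior.\<close>

lemma compact_convex_Riemann_map:
  assumes K: "compact K" "convex K" "0 \<in> K" "k \<in> K" "k \<noteq> 0"
    and \<rho>: "\<rho> \<in> inverted_complement K" "\<rho> \<noteq> 0"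
  obtains j where "j holomorphic_on unit_disk" "inj_on j unit_disk" "j ` unit_disk = inverted_complement K"
    "j 0 = \<rho>" "2 \<le> cmod (pre_schwarzian (\<lambda>z. inverse (j z)) 0)"
proof -
  have "0 \<in> inverted_complement K"
    by (simp add: inverted_complement_def)
  then obtain g where g: "g holomorphic_on unit_disk" "inj_on g unit_disk" "g ` unit_disk = inverted_complement K" "g 0 = 0"
    using Riemann_map_at[OF open_inverted_complement[OF K(1)] simply_connected_inverted_complement[OF K(2,3)]
        inverted_complement_neq_UNIV[OF K(4,5)]] by blast
  obtain gi where gi: "gi holomorphic_on inverted_complement K" "\<And>z. z \<in> unit_disk \<Longrightarrow> gi (g z) = z"
    using holomorphic_has_inverse[OF g(1) open_ball g(2)] g(3) by metis
  interpret compact_exterior_map K g gi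
    using K g gi by unfold_locales
  define b where "b = gi \<rho>"
  have b: "b \<in> unit_disk" "g b = \<rho>" "cmod b < 1"
    using g_gi[OF \<rho>(1)] by (auto simp: b_def)
  have "b \<noteq> 0"
    using b(2) \<rho>(2) g(4) by auto
  let ?T = "Moebius_function 0 (- b)"
  have T: "bij_betw ?T unit_disk unit_disk" "?T holomorphic_on unit_disk"
    using bij_betw_Moebius_function[of "- b"] Moebius_function_holomorphic[of "- b"] b(3) by simp_all
  show thesis
  proof
    show "(\<lambda>z. g (?T z)) holomorphic_on unit_disk"
      using holomorphic_on_compose_gen[OF T(2) g(1)] T(1) by (auto simp: o_def bij_betw_def)
    show "inj_on (\<lambda>z. g (?T z)) unit_disk"
      using comp_inj_on[of ?T unit_disk g] T(1) g(2) by (simp add: o_def bij_betw_def)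
    show "(\<lambda>z. g (?T z)) ` unit_disk = inverted_complement K"
      using T(1) g(3) by (metis bij_betw_def image_image)
    show "g (?T 0) = \<rho>"
      by (simp add: Moebius_function_of_zero b(2))
    have "pre_schwarzian (\<lambda>z. h (?T z)) 0 = 2 * A_op h b"
    proof (rule pre_schwarzian_disk_automorphism)
      have hol: "h holomorphic_on (unit_disk - {0})" "open (unit_disk - {0})" "b \<in> unit_disk - {0}"
        using holomorphic_on_h b \<open>b \<noteq> 0\<close> by auto
      then show "h analytic_on {b}"
        using analytic_at by blast
      have "inj_on h (unit_disk - {0})"
        using g(2) by (auto simp: h_def inj_on_def)
      with hol show "deriv h b \<noteq> 0"
        by (metis holomorphic_injective_imp_regular)
    qed (rule b(3))
    moreover have "1 \<le> cmod (A_op h b)"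
      using A_op_h_ge_1 b(1) \<open>b \<noteq> 0\<close> by simp
    ultimately show "2 \<le> cmod (pre_schwarzian (\<lambda>z. inverse (g (?T z))) 0)"
      by (simp add: h_def norm_mult)
  qed
qed

section \<open>Exhaustion of an unbounded convex complement\<close>

text \<open>The maps \<open>j n\<close> are reciprocals of conformal maps onto the exteriors of the increasing sets
  \<open>K \<inter> cball 0 (R + n)\<close>. Their images decrease to the image of \<open>G\<close> together with the point \<open>0\<close>, which
  stands for infinity. This point is a limit of omitted points, as \<open>K\<close> is unbounded, and hence no
  value of the normal limit of the \<open>j n\<close>, which is an open map. So the limit is subordinate to \<open>G\<close>.
  One index with nearly the right derivative is enough later.\<close>

lemma exhaustion_derivative_limit:
  assumes K: "convex K" "0 \<in> K" "\<not> bounded K" and k: "k \<in> K" "k \<noteq> 0" "cmod k \<le> R"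
    and G: "G holomorphic_on unit_disk" "inj_on G unit_disk" "G ` unit_disk = {r. r \<noteq> 0 \<and> inverse r \<notin> K}"
    and j: "\<And>n. j n holomorphic_on unit_disk" "\<And>n. inj_on (j n) unit_disk"
      "\<And>n::nat. j n ` unit_disk = inverted_complement (K \<inter> cball 0 (R + real n))" "\<And>n. j n 0 = G 0"
    and t: "0 \<le> t" "t < 1"
  shows "\<exists>n. t * cmod (deriv (j n) 0) \<le> cmod (deriv G 0)"
proof (rule ccontr)
  assume "\<not> ?thesis"
  then have less: "cmod (deriv G 0) < t * cmod (deriv (j n) 0)" for n
    by (simp add: not_le)
  \<comment> \<open>All images lie in the complement of one ray, and a Riemann map of that domain turns the j n into
    maps of the disk into itself, a normal family.\<close>
  define S where "S = inverted_complement (closed_segment 0 k)"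
  have "0 \<le> R"
    using k(3) norm_ge_zero[of k] by linarith
  then have seg: "closed_segment 0 k \<subseteq> K \<inter> cball 0 (R + real n)" for n
    using k K(1,2) by (intro closed_segment_subset convex_Int) auto
  have j_S: "j n ` unit_disk \<subseteq> S" for n
    unfolding j(3) S_def by (rule inverted_complement_antimono[OF seg])
  have G_j: "G ` unit_disk \<subseteq> j n ` unit_disk" for n
    unfolding j(3) G(3) by (auto simp: inverted_complement_def)
  have S: "open S" "simply_connected S" "S \<noteq> UNIV" "0 \<in> S"
    using inverted_complement_neq_UNIV[of k "closed_segment 0 k"] k(2)
    unfolding S_def by (simp_all add: open_inverted_complement simply_connected_inverted_complement)
      (simp add: inverted_complement_def)
  obtain L where L: "L holomorphic_on unit_disk" "inj_on L unit_disk" "L ` unit_disk = S"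
    using Riemann_map_at[OF S] by blast
  obtain \<Lambda> where \<Lambda>: "\<Lambda> holomorphic_on S" "\<And>z. z \<in> unit_disk \<Longrightarrow> \<Lambda> (L z) = z"
    using holomorphic_has_inverse[OF L(1) open_ball L(2)] L(3) by metis
  have \<Lambda>_S: "\<Lambda> r \<in> unit_disk" "L (\<Lambda> r) = r" if "r \<in> S" for r
    using that L(3) \<Lambda>(2) by (metis imageE)+
  have inj_\<Lambda>: "inj_on \<Lambda> S"
    using \<Lambda>_S(2) by (metis inj_onI)
  have zero: "(0::complex) \<in> unit_disk"
    by simp
  have \<rho>: "G 0 \<in> S"
    using j_S G_j zero by blast
  define c where "c = deriv \<Lambda> (G 0)"
  have c: "c \<noteq> 0"
    unfolding c_def by (rule holomorphic_injective_imp_regular[OF \<Lambda>(1) S(1) inj_\<Lambda> \<rho>])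
  have hol_comp: "(\<lambda>z. \<Lambda> (u z)) holomorphic_on unit_disk" "deriv (\<lambda>z. \<Lambda> (u z)) 0 = c * deriv u 0"
    if u: "u holomorphic_on unit_disk" "u ` unit_disk \<subseteq> S" "u 0 = G 0" for u
  proof -
    show "(\<lambda>z. \<Lambda> (u z)) holomorphic_on unit_disk"
      using holomorphic_on_compose_gen[OF u(1) \<Lambda>(1) u(2)] by (simp add: o_def)
    have "((\<lambda>z. \<Lambda> (u z)) has_field_derivative c * deriv u 0) (at 0)"
      unfolding c_def u(3)[symmetric]
      by (rule DERIV_chain2[where g = u])
        (use holomorphic_derivI[OF \<Lambda>(1) S(1)] \<rho> u(3) holomorphic_derivI[OF u(1) open_ball zero] in auto)
    then show "deriv (\<lambda>z. \<Lambda> (u z)) 0 = c * deriv u 0"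
      by (rule DERIV_imp_deriv)
  qed
  define f where "f n z = \<Lambda> (j n z)" for n z
  have f: "f n holomorphic_on unit_disk" "deriv (f n) 0 = c * deriv (j n) 0" for n
    using hol_comp[OF j(1) j_S j(4)] by (simp_all add: f_def[abs_def])
  have f_disk: "f n z \<in> unit_disk" if "z \<in> unit_disk" for n z
    unfolding f_def using that j_S by (intro \<Lambda>_S) blast
  obtain l r where l: "l holomorphic_on unit_disk" and r: "strict_mono (r :: nat \<Rightarrow> nat)"
    and lim: "\<And>z. z \<in> unit_disk \<Longrightarrow> ((\<lambda>n. f (r n) z) \<longlongrightarrow> l z) sequentially"
    and ulim: "\<And>X. compact X \<Longrightarrow> X \<subseteq> unit_disk \<Longrightarrow> uniform_limit X (f \<circ> r) l sequentially"
  proof (rule Montel[of unit_disk "range f" f])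
    show "\<exists>B. \<forall>h\<in>range f. \<forall>z\<in>X. cmod (h z) \<le> B" if "compact X" "X \<subseteq> unit_disk" for X
      using that f_disk by (intro exI[of _ 1]) (force intro: less_imp_le)
  qed (use f(1) in auto)
  have dlim: "(\<lambda>n. c * deriv (j (r n)) 0) \<longlonglongrightarrow> deriv l 0"
  proof -
    have "\<exists>d>0. cball z d \<subseteq> unit_disk \<and> uniform_limit (cball z d) (\<lambda>n. f (r n)) l sequentially"
      if z: "z \<in> unit_disk" for z
    proof -
      obtain d where "d > 0" "cball z d \<subseteq> unit_disk"
        using z by (meson open_ball open_contains_cball)
      then show ?thesis
        using ulim[of "cball z d"] by (auto simp: o_def)
    qed
    then have "\<exists>l'. \<forall>z\<in>unit_disk. (l has_field_derivative l' z) (at z) \<and> ((\<lambda>n. deriv (f (r n)) z) \<longlongrightarrow> l' z) sequentially"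
      using holomorphic_derivI[OF f(1) open_ball]
      by (intro has_complex_derivative_uniform_sequence[of unit_disk "\<lambda>n. f (r n)"]) blast+
    then obtain l' where
      "\<forall>z\<in>unit_disk. (l has_field_derivative l' z) (at z) \<and> ((\<lambda>n. deriv (f (r n)) z) \<longlongrightarrow> l' z) sequentially"
      by (elim exE)
    from bspec[OF this zero] show ?thesis
      by (auto simp: f(2) dest!: DERIV_imp_deriv)
  qed
  \<comment> \<open>Subordination of G to j n keeps the derivatives away from 0.\<close>
  have "deriv l 0 \<noteq> 0"
  proof
    assume "deriv l 0 = 0"
    then have null: "(\<lambda>n. cmod (c * deriv (j (r n)) 0)) \<longlonglongrightarrow> 0"
      using tendsto_norm[OF dlim] by simp
    have "cmod (deriv G 0) \<le> cmod (deriv (j n) 0)" for n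
      by (rule subordination[OF j(1)[of n] j(2)[of n] G(1) G_j j(4)[of n, symmetric]])
    then have "cmod c * cmod (deriv G 0) \<le> cmod (c * deriv (j (r n)) 0)" for n
      by (simp add: norm_mult mult_left_mono)
    then have "cmod c * cmod (deriv G 0) \<le> 0"
      by (intro LIMSEQ_le_const[OF null] exI[of _ 0] allI impI)
    moreover have "deriv G 0 \<noteq> 0"
      by (rule holomorphic_injective_imp_regular[OF G(1) open_ball G(2) zero])
    ultimately show False
      using c by (auto simp: mult_le_0_iff)
  qed
  have nonconst: "\<not> (\<lambda>z. l z - s) constant_on unit_disk" for s
  proof
    assume "(\<lambda>z. l z - s) constant_on unit_disk"
    then obtain d where "\<And>z. z \<in> unit_disk \<Longrightarrow> l z = d + s"
      unfolding constant_on_def by (metis diff_add_cancel)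
    then have "eventually (\<lambda>z. l z = d + s) (nhds 0)"
      by (rule eventually_mono[OF eventually_nhds_in_open[OF open_ball zero]])
    then have "deriv l 0 = deriv (\<lambda>z. d + s) 0"
      by (rule deriv_cong_ev) simp
    with \<open>deriv l 0 \<noteq> 0\<close> show False
      by simp
  qed
  have "open (l ` A)" if "open A" "A \<subseteq> unit_disk" for A
    using open_mapping_thm[OF l open_ball _ that] nonconst[of 0] by simp
  then have open_l: "open (l ` unit_disk)"
    by simp
  have l_cball: "l ` unit_disk \<subseteq> cball 0 1"
  proof
    fix s assume "s \<in> l ` unit_disk"
    then obtain z where z: "z \<in> unit_disk" "s = l z"
      by blast
    have "cmod (l z) \<le> 1"
      using f_disk[OF z(1)] by (intro LIMSEQ_le_const2[OF tendsto_norm[OF lim[OF z(1)]]]) (auto intro: less_imp_le)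
    with z(2) show "s \<in> cball 0 1"
      by simp
  qed
  then have l_disk: "l ` unit_disk \<subseteq> unit_disk"
    using interior_maximal[OF l_cball open_l] by (simp add: interior_cball)
  \<comment> \<open>A value omitted by G is 0 or the inverse of a point of K. A point of K is omitted by j n for all large n,
    hence by the limit; and if the open image contained 0, then it would also contain inverses of points of
    K, as K is unbounded.\<close>
  have L_l: "L ` (l ` unit_disk) \<subseteq> G ` unit_disk"
  proof
    fix r0 assume r0: "r0 \<in> L ` (l ` unit_disk)"
    show "r0 \<in> G ` unit_disk"
    proof (rule ccontr)
      assume notin: "r0 \<notin> G ` unit_disk"
      have op: "open (L ` (l ` unit_disk))"
        by (rule open_mapping_thm3[OF _ open_l])
          (use L l_disk in \<open>auto intro: holomorphic_on_subset inj_on_subset\<close>)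
      obtain r1 where r1: "r1 \<in> L ` (l ` unit_disk)" "r1 \<noteq> 0" "inverse r1 \<in> K"
      proof (cases "r0 = 0")
        case True
        then obtain e where e: "e > 0" "ball 0 e \<subseteq> L ` (l ` unit_disk)"
          using op r0 openE by blast
        obtain a where a: "a \<in> K" "1 / e < cmod a"
          using K(3) unfolding bounded_iff by (meson not_le)
        have "0 < cmod a"
          using a(2) e(1) by (meson divide_pos_pos less_trans zero_less_one)
        moreover from this have "inverse (cmod a) < e"
          using a(2) e(1) by (simp add: field_simps)
        ultimately have "inverse a \<in> ball 0 e" "inverse a \<noteq> 0"
          by (auto simp: norm_inverse)
        then show thesis
          using e(2) a(1) by (intro that[of "inverse a"]) auto
      next
        case False
        then show thesis
          using notin r0 G(3) by (intro that[of r0]) auto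
      qed
      obtain z where z: "z \<in> unit_disk" "r1 = L (l z)"
        using r1(1) by blast
      define N where "N = nat \<lceil>cmod (inverse r1) + \<bar>R\<bar>\<rceil>"
      have "l z - l z \<noteq> 0"
      proof (rule Hurwitz_no_zeros[of unit_disk "\<lambda>m w. f (r (m + N)) w - l z" "\<lambda>w. l w - l z" z])
        show "uniform_limit X (\<lambda>m w. f (r (m + N)) w - l z) (\<lambda>w. l w - l z) sequentially"
          if "compact X" "X \<subseteq> unit_disk" for X
        proof -
          from filterlim_compose[OF ulim[OF that] filterlim_add_const_nat_at_top[of N]]
          have "uniform_limit X (\<lambda>m. f (r (m + N))) l sequentially"
            by (simp add: o_def)
          then show ?thesis
            by (intro uniform_limit_minus uniform_limit_const) auto
        qed
        show "f (r (m + N)) w - l z \<noteq> 0" if w: "w \<in> unit_disk" for m w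
        proof
          assume "f (r (m + N)) w - l z = 0"
          then have "L (\<Lambda> (j (r (m + N)) w)) = r1"
            using z(2) by (simp add: f_def)
          moreover have "j (r (m + N)) w \<in> S"
            using j_S w by blast
          ultimately have "r1 = j (r (m + N)) w"
            by (simp add: \<Lambda>_S(2))
          then have "r1 \<in> inverted_complement (K \<inter> cball 0 (R + real (r (m + N))))"
            unfolding j(3)[symmetric] using w by blast
          moreover have "cmod (inverse r1) \<le> R + real (r (m + N))"
          proof -
            have "N \<le> r (m + N)"
              using seq_suble[OF r, of "m + N"] by simp
            moreover have "cmod (inverse r1) + \<bar>R\<bar> \<le> real N"
              unfolding N_def by linarith
            ultimately show ?thesis
              by linarith
          qed
          ultimately show False
            using r1(2,3) by (simp add: inverted_complement_def)
        qed
      qed (use f(1) l nonconst z in \<open>auto intro!: holomorphic_intros\<close>)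
      then show False
        by simp
    qed
  qed
  have G_S: "G ` unit_disk \<subseteq> S"
    using G_j j_S by blast
  have "cmod (deriv l 0) \<le> cmod (deriv (\<lambda>z. \<Lambda> (G z)) 0)"
  proof -
    have "inj_on (\<lambda>z. \<Lambda> (G z)) unit_disk"
      using comp_inj_on[OF G(2) inj_on_subset[OF inj_\<Lambda> G_S]] by (simp add: o_def)
    moreover have "l ` unit_disk \<subseteq> (\<lambda>z. \<Lambda> (G z)) ` unit_disk"
    proof
      fix s assume s: "s \<in> l ` unit_disk"
      then obtain w where "w \<in> unit_disk" "L s = G w"
        using L_l by blast
      then show "s \<in> (\<lambda>z. \<Lambda> (G z)) ` unit_disk"
        using \<Lambda>(2)[of s] s l_disk by force
    qed
    moreover have "l 0 = \<Lambda> (G 0)"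
      using lim[OF zero] by (simp add: f_def j(4) LIMSEQ_const_iff)
    ultimately show ?thesis
      using subordination[OF hol_comp(1)[OF G(1) G_S refl] _ l] by blast
  qed
  also have "\<dots> = cmod c * cmod (deriv G 0)"
    by (simp add: hol_comp(2)[OF G(1) G_S refl] norm_mult)
  also have "\<dots> \<le> t * cmod (deriv l 0)"
  proof (rule LIMSEQ_le_const)
    show "(\<lambda>n. t * cmod (c * deriv (j (r n)) 0)) \<longlonglongrightarrow> t * cmod (deriv l 0)"
      by (intro tendsto_intros dlim)
    have "cmod c * cmod (deriv G 0) \<le> t * cmod (c * deriv (j (r n)) 0)" for n
      using mult_left_mono[OF less_imp_le[OF less[of "r n"]], of "cmod c"] by (simp add: norm_mult mult_ac)
    then show "\<exists>N. \<forall>n\<ge>N. cmod c * cmod (deriv G 0) \<le> t * cmod (c * deriv (j (r n)) 0)"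
      by blast
  qed
  finally have "1 * cmod (deriv l 0) \<le> t * cmod (deriv l 0)"
    by simp
  moreover have "0 < cmod (deriv l 0)"
    using \<open>deriv l 0 \<noteq> 0\<close> by simp
  ultimately have "1 \<le> t"
    by (simp only: mult_le_cancel_right_pos)
  with t(2) show False
    by simp
qed

section \<open>Necessity\<close>

text \<open>By the chain rule for the factorization of \<open>F\<close> through an exterior map \<open>h\<close> of a compact convex set
  and a self-map \<open>\<sigma>\<close> of the disk, the pre-Schwarzian of \<open>F\<close> at \<open>0\<close> is \<open>P \<sigma>' + \<sigma>'' / \<sigma>'\<close> with
  \<open>\<bar>P\<bar> \<ge> 2\<close>. When \<open>\<bar>\<sigma>'\<bar>\<close> is close to one, the second coefficient bound makes the last term small.\<close>

lemma pre_schwarzian_0_ge_2: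
  assumes F: "F holomorphic_on unit_disk" "inj_on F unit_disk"
    and conv: "convex (- (F ` unit_disk))" and zero: "0 \<notin> F ` unit_disk"
  shows "2 \<le> cmod (pre_schwarzian F 0)"
proof -
  define K where "K = - (F ` unit_disk)"
  have K: "convex K" "0 \<in> K" "\<not> bounded K" "closed K"
    using conv zero unbounded_complement_of_injective_image[OF F] open_mapping_thm3[OF F(1) open_ball F(2)]
    by (auto simp: K_def closed_def)
  obtain k where k: "k \<in> K" "k \<noteq> 0"
    using K(3) by (metis bounded_empty bounded_insert bounded_subset insertI1 subsetI)
  define G where "G z = inverse (F z)" for z
  have F_nz: "F z \<noteq> 0" if "z \<in> unit_disk" for z
    using zero that by (metis imageI)
  have G: "G holomorphic_on unit_disk" "inj_on G unit_disk" "G ` unit_disk = {r. r \<noteq> 0 \<and> inverse r \<notin> K}"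
  proof -
    show "G holomorphic_on unit_disk"
      unfolding G_def[abs_def] using F(1) F_nz by (intro holomorphic_intros) auto
    show "inj_on G unit_disk"
      using F(2) by (auto simp: G_def inj_on_def)
    show "G ` unit_disk = {r. r \<noteq> 0 \<and> inverse r \<notin> K}"
    proof (intro equalityI subsetI)
      fix r assume "r \<in> {r. r \<noteq> 0 \<and> inverse r \<notin> K}"
      then obtain z where "z \<in> unit_disk" "inverse r = F z"
        by (auto simp: K_def)
      then show "r \<in> G ` unit_disk"
        unfolding G_def by (metis image_eqI inverse_inverse_eq)
    qed (use F_nz in \<open>auto simp: G_def K_def\<close>)
  qed
  define R where "R = cmod k"
  have in_disk: "(0::complex) \<in> unit_disk"
    by simp
  have "\<exists>j. j holomorphic_on unit_disk \<and> inj_on j unit_disk \<and> j ` unit_disk = inverted_complement (K \<inter> cball 0 (R + real n))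
      \<and> j 0 = G 0 \<and> 2 \<le> cmod (pre_schwarzian (\<lambda>z. inverse (j z)) 0)" for n
  proof -
    have "G 0 \<in> inverted_complement (K \<inter> cball 0 (R + real n))" "G 0 \<noteq> 0"
      using G(3) in_disk by (auto simp: inverted_complement_def set_eq_iff)
    moreover have "compact (K \<inter> cball 0 (R + real n))"
      using K(4) by (simp add: closed_Int_compact)
    moreover have "convex (K \<inter> cball 0 (R + real n))"
      using K(1) by (intro convex_Int) auto
    moreover have "0 \<in> K \<inter> cball 0 (R + real n)" "k \<in> K \<inter> cball 0 (R + real n)"
      using K(2) k by (auto simp: R_def)
    ultimately show ?thesis
      using compact_convex_Riemann_map[of "K \<inter> cball 0 (R + real n)" k "G 0"] k(2) by metis
  qed
  then obtain j where j: "\<And>n. j n holomorphic_on unit_disk" "\<And>n. inj_on (j n) unit_disk"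
      "\<And>n::nat. j n ` unit_disk = inverted_complement (K \<inter> cball 0 (R + real n))" "\<And>n. j n 0 = G 0"
      "\<And>n. 2 \<le> cmod (pre_schwarzian (\<lambda>z. inverse (j n z)) 0)"
    by metis
  have dG: "deriv G 0 \<noteq> 0"
    by (rule holomorphic_injective_imp_regular[OF G(1) open_ball G(2) in_disk])
  have bound: "2 * t - 2 * (1 - t\<^sup>2) / t \<le> cmod (pre_schwarzian F 0)" if t: "0 < t" "t < 1" for t
  proof -
    obtain n where n: "t * cmod (deriv (j n) 0) \<le> cmod (deriv G 0)"
      using exhaustion_derivative_limit[of K k R G j t] K(1-3) k G j(1-4) t by (auto simp: R_def)
    have "G ` unit_disk \<subseteq> j n ` unit_disk"
      unfolding j(3) G(3) by (auto simp: inverted_complement_def)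
    from subordination[OF j(1,2) G(1) this j(4)[symmetric]]
    obtain \<sigma> where \<sigma>: "\<sigma> holomorphic_on unit_disk" "\<sigma> \<in> unit_disk \<rightarrow> unit_disk" "\<sigma> 0 = 0"
      "\<And>z. z \<in> unit_disk \<Longrightarrow> G z = j n (\<sigma> z)" "deriv G 0 = deriv (j n) 0 * deriv \<sigma> 0" "cmod (deriv \<sigma> 0) \<le> 1"
      by metis
    \<comment> \<open>G is j n after a self-map of the disk that is close to a rotation, with derivative of modulus at least t.\<close>
    define s where "s = cmod (deriv \<sigma> 0)"
    have dj: "deriv (j n) 0 \<noteq> 0" and d\<sigma>: "deriv \<sigma> 0 \<noteq> 0"
      using dG \<sigma>(5) by auto
    have "t \<le> s"
      using n dj unfolding \<sigma>(5) s_def norm_mult by (simp add: mult.commute)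
    have s: "0 < s" "s \<le> 1"
      using d\<sigma> \<sigma>(6) by (auto simp: s_def)
    define h where "h z = inverse (j n z)" for z
    have j0: "j n 0 \<noteq> 0"
      using j(4) F_nz[OF in_disk] by (simp add: G_def)
    have ana_j: "j n analytic_on {0}" and ana_\<sigma>: "\<sigma> analytic_on {0}"
      using j(1) \<sigma>(1) in_disk analytic_at open_ball by blast+
    have "(h has_field_derivative - (inverse (j n 0) * deriv (j n) 0 * inverse (j n 0))) (at 0)"
      unfolding h_def[abs_def] by (rule DERIV_inverse'[OF holomorphic_derivI[OF j(1) open_ball in_disk] j0])
    then have dh: "deriv h 0 \<noteq> 0"
      using j0 dj by (simp add: DERIV_imp_deriv)
    have "pre_schwarzian F 0 = pre_schwarzian (\<lambda>z. h (\<sigma> z)) 0"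
    proof (rule pre_schwarzian_cong_ev)
      have "F z = h (\<sigma> z)" if "z \<in> unit_disk" for z
        unfolding h_def \<sigma>(4)[OF that, symmetric] G_def by simp
      then show "eventually (\<lambda>z. F z = h (\<sigma> z)) (nhds 0)"
        by (rule eventually_mono[OF eventually_nhds_in_open[OF open_ball in_disk]])
    qed
    also have "\<dots> = pre_schwarzian h 0 * deriv \<sigma> 0 + pre_schwarzian \<sigma> 0"
    proof -
      have "h analytic_on {0}"
        unfolding h_def[abs_def] using ana_j j0 by (intro analytic_intros) auto
      then show ?thesis
        using pre_schwarzian_compose[of h \<sigma> 0] \<sigma>(3) ana_\<sigma> dh d\<sigma> by simp
    qed
    finally have eq: "pre_schwarzian F 0 = pre_schwarzian h 0 * deriv \<sigma> 0 + pre_schwarzian \<sigma> 0" .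
    have "2 * s \<le> cmod (pre_schwarzian h 0 * deriv \<sigma> 0)"
      using j(5)[of n] s(1) unfolding h_def[abs_def] norm_mult s_def by (intro mult_right_mono) auto
    moreover have "cmod (pre_schwarzian \<sigma> 0) \<le> 2 * (1 - s\<^sup>2) / s"
      using second_coefficient_bound[OF \<sigma>(1-3)] s(1) unfolding pre_schwarzian_def s_def norm_divide
      by (intro divide_right_mono) auto
    ultimately have "2 * s - 2 * (1 - s\<^sup>2) / s \<le> cmod (pre_schwarzian F 0)"
      unfolding eq using norm_diff_ineq[of "pre_schwarzian h 0 * deriv \<sigma> 0" "pre_schwarzian \<sigma> 0"] by linarith
    moreover have "2 * (1 - s\<^sup>2) / s \<le> 2 * (1 - t\<^sup>2) / t"
    proof (rule frac_le)
      show "2 * (1 - s\<^sup>2) \<le> 2 * (1 - t\<^sup>2)"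
        using \<open>t \<le> s\<close> t by (simp add: power_mono)
      show "0 \<le> 2 * (1 - t\<^sup>2)"
        using t by (simp add: abs_square_le_1)
    qed (use \<open>t \<le> s\<close> t in auto)
    ultimately show ?thesis
      using \<open>t \<le> s\<close> by linarith
  qed
  have "((\<lambda>t. 2 * t - 2 * (1 - t\<^sup>2) / t) \<longlongrightarrow> 2 * 1 - 2 * (1 - 1\<^sup>2) / 1) (at_left (1::real))"
    by (intro tendsto_intros) auto
  moreover have "eventually (\<lambda>t. 2 * t - 2 * (1 - t\<^sup>2) / t \<le> cmod (pre_schwarzian F 0)) (at_left (1::real))"
    unfolding eventually_at_left_field using bound by (intro exI[of _ 0]) auto
  ultimately have "2 * 1 - 2 * (1 - 1\<^sup>2) / 1 \<le> cmod (pre_schwarzian F 0)"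
    by (intro tendsto_upperbound) auto
  then show ?thesis
    by simp
qed

theorem A_op_ge_1_if_convex_complement:
  assumes f: "f holomorphic_on unit_disk" "inj_on f unit_disk"
    and conv: "convex (- (f ` unit_disk))" and z: "z \<in> unit_disk"
  shows "1 \<le> cmod (A_op f z)"
proof -
  obtain k where k: "k \<notin> f ` unit_disk"
    using unbounded_complement_of_injective_image[OF f] by (metis Compl_iff bounded_empty equals0I)
  let ?T = "Moebius_function 0 (- z)"
  define F where "F w = f (?T w) - k" for w
  have T: "bij_betw ?T unit_disk unit_disk" "?T holomorphic_on unit_disk"
    using bij_betw_Moebius_function[of "- z"] Moebius_function_holomorphic[of "- z"] z by simp_all
  have image: "F ` unit_disk = (\<lambda>a. a - k) ` (f ` unit_disk)"
  proof -
    have "F ` unit_disk = (\<lambda>a. a - k) ` (f ` (?T ` unit_disk))"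
      by (simp add: F_def[abs_def] image_image)
    then show ?thesis
      using T(1) by (simp add: bij_betw_def)
  qed
  have fT: "(\<lambda>w. f (?T w)) holomorphic_on unit_disk"
    using holomorphic_on_compose_gen[OF T(2) f(1)] T(1) by (auto simp: o_def bij_betw_def)
  have "2 \<le> cmod (pre_schwarzian F 0)"
  proof (rule pre_schwarzian_0_ge_2)
    show "F holomorphic_on unit_disk"
      unfolding F_def[abs_def] by (intro holomorphic_intros fT)
    show "inj_on F unit_disk"
    proof -
      have "inj_on (f \<circ> ?T) unit_disk"
        by (rule comp_inj_on) (use T(1) f(2) in \<open>simp_all add: bij_betw_def\<close>)
      then show ?thesis
        by (simp add: F_def inj_on_def)
    qed
    have "- (F ` unit_disk) = (\<lambda>a. a - k) ` (- (f ` unit_disk))"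
      unfolding image by (rule bij_image_Compl_eq[symmetric]) (rule bij_diff_right)
    then show "convex (- (F ` unit_disk))"
      using convex_translation_subtract[OF conv, of k] by simp
    show "0 \<notin> F ` unit_disk"
      using k unfolding image by auto
  qed
  also have "pre_schwarzian F 0 = pre_schwarzian (\<lambda>w. f (?T w)) 0"
  proof (rule pre_schwarzian_cong_deriv)
    show "eventually (\<lambda>w. deriv F w = deriv (\<lambda>w. f (?T w)) w) (nhds 0)"
      using eventually_nhds_in_open[of unit_disk 0]
    proof (rule eventually_mono)
      fix w :: complex assume "w \<in> unit_disk"
      from holomorphic_derivI[OF fT open_ball this]
      have "(F has_field_derivative deriv (\<lambda>w. f (?T w)) w - 0) (at w)"
        unfolding F_def[abs_def] by (intro DERIV_diff DERIV_const)
      then show "deriv F w = deriv (\<lambda>w. f (?T w)) w"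
        by (simp add: DERIV_imp_deriv)
    qed auto
  qed
  also have "\<dots> = 2 * A_op f z"
    using f(1) z analytic_at open_ball holomorphic_injective_imp_regular[OF f(1) open_ball f(2) z]
    by (intro pre_schwarzian_disk_automorphism) (blast, simp_all)
  finally show ?thesis
    by (simp add: norm_mult)
qed

section \<open>The characterization of concave mappings\<close>

theorem theorem1:
  fixes f :: "complex \<Rightarrow> complex"
  assumes "f holomorphic_on unit_disk"
    and "inj_on f unit_disk"
    and "infinite_at_one f"
  shows "f \<in> Co \<longleftrightarrow>
    (\<forall>z\<in>unit_disk. cmod (schwarzian f z) * (1 - (cmod z)\<^sup>2)\<^sup>2 + 2 \<le> 2 * (cmod (A_op f z))\<^sup>2)"
proof -
  have "deriv f z \<noteq> 0" if "z \<in> unit_disk" for z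
    using holomorphic_injective_imp_regular[OF assms(1) open_ball assms(2) that] .
  note schwarzian_bound_iff_A_op_ge_1[OF assms(1) this]
  moreover have "f \<in> Co \<longleftrightarrow> convex (- (f ` unit_disk))"
    using assms by (simp add: Co_def)
  moreover have "convex (- (f ` unit_disk)) \<longleftrightarrow> (\<forall>z\<in>unit_disk. 1 \<le> cmod (A_op f z))"
    using convex_complement_if_A_op_ge_1[OF assms] A_op_ge_1_if_convex_complement[OF assms(1,2)] by blast
  ultimately show ?thesis
    by simp
qed

end
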